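(* Let $k_1=2$ and $2\le t\le\min\{k_2,d\}$. If $t=2$, the number of combinatorial types in the minimal decomposition of $\mathcal I_C$ is $\lfloor k_2/2\rfloor+1$. If $t\ge3$, the number of combinatorial types in the minimal decomposition of $\mathcal I_C$ is $$\begin{cases}\tfrac12(k_2-t+1)(k_2-t+2)+1&\text{if }t-1\ge\frac{k_2}{2},\\ \tfrac14(k_2^2-2t^2+6t)&\text{if }t-1<\frac{k_2}{2}\text{ and }k_2\text{ is even},\\ \tfrac14(k_2^2-2t^2+6t-1)&\text{if }t-1<\frac{k_2}{2}\text{ and }k_2\text{ is odd}.\end{cases}$$
   Context: Let $k_2,d,t$ be integers with $2\le t\le\min\{k_2,d\}$; write $[n]=\{1,\dots,n\}$. Let $X=(x_{i(j,\ell)})$ be the $d\times 2k_2$ matrix of indeterminates with rows $i\in[d]$ and columns $(j,\ell)\in[2]\times[k_2]$, and $\mathbb C[X]$ the polynomial ring over $\mathbb C$ in its entries. For $U\subseteq[2]\times[k_2]$, $X_U$ is the submatrix of $X$ with columns indexed by $U$. For a submatrix $Y$ of $X$, $F_r(Y)$ denotes the set of $r$-minors of $Y$. Put $R_i=\{i\}\times[k_2]$ and $C_j=[2]\times\{j\}$. The ideal $\mathcal I_C$ is generated by all $2$-minors of $X_{C_j}$ ($j\in[k_2]$) and all $t$-minors of $X_{R_i}$ ($i\in[2]$). For $S\subseteq[2]\times[k_2]$ let $\mathcal C(S)$ be the union of all $C_j$ with $C_j\cap S=\emptyset$. Let $F_\emptyset=\bigcup_{j\in[k_2]}F_2(X_{C_j})\cup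 F_t(X)$ and, for $S\ne\emptyset$, $$F_S=F_1(X_S)\cup\bigcup_{j\in[k_2],\,C_j\cap S=\emptyset}F_2(X_{C_j})\cup G_S\cup F_t(X_{(R_1\setminus S)\cup\mathcal C(S)})\cup F_t(X_{(R_2\setminus S)\cup\mathcal C(S)}),$$ where $G_S=F_{t-1}(X_{\mathcal C(S)})$ if there is $j$ with $(1,j)\in S,(2,j)\notin S$ and there is $j'$ with $(2,j')\in S,(1,j')\notin S$, and $G_S=\emptyset$ otherwise. $I_S\subseteq\mathbb C[X]$ is the ideal generated by $F_S$. If $S$ contains no $C_j$, its combinatorial type is $(u,v)$ with $u=\min\{|R_1\cap S|,|R_2\cap S|\}$, $v=\max\{|R_1\cap S|,|R_2\cap S|\}$. The minimal decomposition of $\mathcal I_C$ is $\sqrt{\mathcal I_C}=\bigcap\sqrt{I_S}$ over all $S$ for which $I_S$ is minimal with respect to inclusion among $\{I_{S'}:S'\subseteq[2]\times[k_2]\}$. The number of combinatorial types in it is the number of distinct pairs $(u,v)$ that occur as the combinatorial type of some $S\subseteq[2]\times[k_2]$ containing no $C_j$ with $I_S$ minimal in this sense (including the pair $(0,0)$, which is the type of $S=\emptyset$). *)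

theory Defs
  imports
    Complex_Main
    "HOL-Library.Poly_Mapping"
    "HOL-Library.Product_Lexorder"
    "HOL-Algebra.Ideal"
    "Jordan_Normal_Form.Determinant"
begin

text \<open>
  The indeterminate in row \<open>i\<close> and column \<open>(j, l)\<close> is indexed by the triple \<open>(i, (j, l))\<close>;
  all indices start at 1. A polynomial is a finitely supported map from monomials (finitely
  supported exponent maps) to coefficients, with the convolution product of
  \<^theory>\<open>HOL-Library.Poly_Mapping\<close>.
\<close>

type_synonym column = "nat \<times> nat"
type_synonym cpoly = "((nat \<times> column) \<Rightarrow>\<^sub>0 nat) \<Rightarrow>\<^sub>0 complex"

definition indet :: "nat \<Rightarrow> column \<Rightarrow> cpoly" where
  "indet i c = Poly_Mapping.single (Poly_Mapping.single (i, c) 1) 1"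

definition columns :: "nat \<Rightarrow> column set" where
  "columns k = {1..2} \<times> {1..k}"

text \<open>
  The type \<^typ>\<open>cpoly\<close> has infinitely many indeterminates. The ring \<open>\<complex>[X]\<close> consists of
  the polynomials in which only entries of the \<open>d \<times> 2k\<close> matrix \<open>X\<close> occur.
\<close>

definition poly_ring :: "nat \<Rightarrow> nat \<Rightarrow> cpoly ring" where
  "poly_ring d k =
     \<lparr>carrier = {p. \<forall>m \<in> Poly_Mapping.keys p. Poly_Mapping.keys m \<subseteq> {1..d} \<times> columns k},
      monoid.mult = (*), one = 1, zero = 0, add = (+)\<rparr>"

lemma cring_poly_ring: "cring (poly_ring d k)"
proof -
  define V where "V = {1..d} \<times> columns k"
  define C :: "cpoly set"
    where "C = {p. \<forall>m \<in> Poly_Mapping.keys p. Poly_Mapping.keys m \<subseteq> V}"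
  have R: "poly_ring d k = \<lparr>carrier = C, monoid.mult = (*), one = 1, zero = 0, add = (+)\<rparr>"
    by (simp add: poly_ring_def C_def V_def)
  have zero: "0 \<in> C" and one: "1 \<in> C"
    by (auto simp: C_def)
  have add: "p + q \<in> C" if "p \<in> C" "q \<in> C" for p q
    using that Poly_Mapping.keys_add[of p q] unfolding C_def by blast
  have neg: "- p \<in> C" if "p \<in> C" for p
    using that by (simp add: C_def)
  have mult: "p * q \<in> C" if "p \<in> C" "q \<in> C" for p q
  proof -
    have "Poly_Mapping.keys m \<subseteq> V" if m: "m \<in> Poly_Mapping.keys (p * q)" for m
    proof -
      from m keys_mult[of p q] obtain a b
        where "m = a + b" "a \<in> Poly_Mapping.keys p" "b \<in> Poly_Mapping.keys q" by blast
      then show ?thesis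
        using \<open>p \<in> C\<close> \<open>q \<in> C\<close> Poly_Mapping.keys_add[of a b] unfolding C_def by blast
    qed
    then show ?thesis by (simp add: C_def)
  qed
  show ?thesis
    unfolding R
  proof (rule cringI)
    show "abelian_group \<lparr>carrier = C, monoid.mult = (*), one = 1, zero = 0, add = (+)\<rparr>"
    proof (rule abelian_groupI)
      fix x assume "x \<in> carrier \<lparr>carrier = C, monoid.mult = (*), one = 1, zero = 0, add = (+)\<rparr>"
      then show "\<exists>y \<in> carrier \<lparr>carrier = C, monoid.mult = (*), one = 1, zero = 0, add = (+)\<rparr>.
          y \<oplus>\<^bsub>\<lparr>carrier = C, monoid.mult = (*), one = 1, zero = 0, add = (+)\<rparr>\<^esub> x
          = \<zero>\<^bsub>\<lparr>carrier = C, monoid.mult = (*), one = 1, zero = 0, add = (+)\<rparr>\<^esub>"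
        by (auto intro!: bexI[of _ "- x"] neg)
    qed (auto simp: zero add algebra_simps)
    show "Group.comm_monoid \<lparr>carrier = C, monoid.mult = (*), one = 1, zero = 0, add = (+)\<rparr>"
      by (rule comm_monoidI) (auto simp: one mult algebra_simps)
  qed (auto simp: algebra_simps)
qed

text \<open>
  Rows are taken in increasing order and columns in lexicographic order; another order of the
  columns would change minors only by a sign.
\<close>

definition minor :: "nat set \<Rightarrow> column set \<Rightarrow> cpoly" where
  "minor I J = det (mat (card I) (card J)
     (\<lambda>(a, b). indet (sorted_list_of_set I ! a) (sorted_list_of_set J ! b)))"

definition minors :: "nat \<Rightarrow> nat \<Rightarrow> column set \<Rightarrow> cpoly set" where
  "minors d r U = {minor I J | I J. I \<subseteq> {1..d} \<and> J \<subseteq> U \<and> card I = r \<and> card J = r}"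

definition row_block :: "nat \<Rightarrow> nat \<Rightarrow> column set" where
  "row_block k i = {i} \<times> {1..k}"

definition col_block :: "nat \<Rightarrow> column set" where
  "col_block j = {1..2} \<times> {j}"

definition free_blocks :: "nat \<Rightarrow> column set \<Rightarrow> column set" where
  "free_blocks k S = (\<Union>j \<in> {j \<in> {1..k}. col_block j \<inter> S = {}}. col_block j)"

definition gens_G :: "nat \<Rightarrow> nat \<Rightarrow> nat \<Rightarrow> column set \<Rightarrow> cpoly set" where
  "gens_G d k t S =
     (if (\<exists>j \<in> {1..k}. (1, j) \<in> S \<and> (2, j) \<notin> S) \<and> (\<exists>j \<in> {1..k}. (2, j) \<in> S \<and> (1, j) \<notin> S)
      then minors d (t - 1) (free_blocks k S) else {})"

definition gens_F :: "nat \<Rightarrow> nat \<Rightarrow> nat \<Rightarrow> column set \<Rightarrow> cpoly set" where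
  "gens_F d k t S =
     (if S = {} then (\<Union>j \<in> {1..k}. minors d 2 (col_block j)) \<union> minors d t (columns k)
      else minors d 1 S
         \<union> (\<Union>j \<in> {j \<in> {1..k}. col_block j \<inter> S = {}}. minors d 2 (col_block j))
         \<union> gens_G d k t S
         \<union> minors d t ((row_block k 1 - S) \<union> free_blocks k S)
         \<union> minors d t ((row_block k 2 - S) \<union> free_blocks k S))"

definition ideal_I :: "nat \<Rightarrow> nat \<Rightarrow> nat \<Rightarrow> column set \<Rightarrow> cpoly set" where
  "ideal_I d k t S = Idl\<^bsub>poly_ring d k\<^esub> (gens_F d k t S)"

text \<open>Outside the carrier, \<^const>\<open>genideal\<close> would degenerate to \<^const>\<open>UNIV\<close>.\<close>

lemma gens_F_in_poly_ring:
  assumes "S \<subseteq> columns k"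
  shows "gens_F d k t S \<subseteq> carrier (poly_ring d k)"
proof -
  interpret cring "poly_ring d k" by (rule cring_poly_ring)
  have indet: "indet i c \<in> carrier (poly_ring d k)" if "i \<in> {1..d}" "c \<in> columns k" for i c
    using that by (simp add: indet_def poly_ring_def)
  have sum_in: "sum f A \<in> carrier (poly_ring d k)"
    if "\<And>a. a \<in> A \<Longrightarrow> f a \<in> carrier (poly_ring d k)" for f and A :: "(nat \<Rightarrow> nat) set"
    using that
  proof (induction A rule: infinite_finite_induct)
    case (insert x F)
    then have "f x \<oplus>\<^bsub>poly_ring d k\<^esub> sum f F \<in> carrier (poly_ring d k)" by blast
    with insert show ?case by (simp add: poly_ring_def)
  qed (simp_all add: poly_ring_def)
  have prod_in: "prod f A \<in> carrier (poly_ring d k)"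
    if "\<And>a. a \<in> A \<Longrightarrow> f a \<in> carrier (poly_ring d k)" for f and A :: "nat set"
    using that
  proof (induction A rule: infinite_finite_induct)
    case (insert x F)
    then have "f x \<otimes>\<^bsub>poly_ring d k\<^esub> prod f F \<in> carrier (poly_ring d k)" by blast
    with insert show ?case by (simp add: poly_ring_def)
  qed (simp_all add: poly_ring_def)
  have neg_in: "- p \<in> carrier (poly_ring d k)" if "p \<in> carrier (poly_ring d k)" for p
    using that by (simp add: poly_ring_def)
  have minor: "minor I J \<in> carrier (poly_ring d k)"
    if I: "I \<subseteq> {1..d}" and J: "J \<subseteq> columns k" and IJ: "card I = card J" for I J
  proof -
    have fin: "finite I" "finite J"
      using finite_subset[OF I] finite_subset[OF J] by (simp_all add: columns_def)
    have entry: "indet (sorted_list_of_set I ! a) (sorted_list_of_set J ! b)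
        \<in> carrier (poly_ring d k)" if "a < card J" "b < card J" for a b
    proof (rule indet)
      show "sorted_list_of_set I ! a \<in> {1..d}"
        using that(1) I IJ fin nth_mem[of a "sorted_list_of_set I"] by auto
      show "sorted_list_of_set J ! b \<in> columns k"
        using that(2) J fin nth_mem[of b "sorted_list_of_set J"] by auto
    qed
    have sgn: "of_int (sign p) * q \<in> carrier (poly_ring d k)"
      if "q \<in> carrier (poly_ring d k)" for p :: "nat \<Rightarrow> nat" and q
      using that neg_in by (simp add: sign_def)
    have "of_int (sign p) * (\<Prod>i = 0..<card J. indet (sorted_list_of_set I ! i)
        (sorted_list_of_set J ! p i)) \<in> carrier (poly_ring d k)"
      if p: "p permutes {0..<card J}" for p
    proof (intro sgn prod_in entry)
      fix i assume "i \<in> {0..<card J}"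
      then show "i < card J" "p i < card J"
        using permutes_in_image[OF p, of i] by simp_all
    qed
    then have "(\<Sum>p \<in> {p. p permutes {0..<card J}}. of_int (sign p) *
        (\<Prod>i = 0..<card J. indet (sorted_list_of_set I ! i) (sorted_list_of_set J ! p i)))
        \<in> carrier (poly_ring d k)"
      by (intro sum_in) simp
    then show ?thesis
      using IJ by (simp add: minor_def det_def)
  qed
  have minors: "minors d r U \<subseteq> carrier (poly_ring d k)" if "U \<subseteq> columns k" for r U
  proof
    fix p assume "p \<in> minors d r U"
    then obtain I J where "p = minor I J" "I \<subseteq> {1..d}" "J \<subseteq> U" "card I = card J"
      unfolding minors_def mem_Collect_eq by metis
    with that minor[of I J] show "p \<in> carrier (poly_ring d k)" by blast
  qed
  have sub: "col_block j \<subseteq> columns k" if "j \<in> {1..k}" for j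
    using that by (auto simp: col_block_def columns_def)
  have fb: "free_blocks k S \<subseteq> columns k"
    using sub unfolding free_blocks_def by blast
  have rb: "row_block k i - S \<subseteq> columns k" if "i \<in> {1..2}" for i
    using that unfolding row_block_def columns_def by blast
  have G: "gens_G d k t S \<subseteq> carrier (poly_ring d k)"
    using minors[OF fb] by (simp add: gens_G_def)
  have "minors d t ((row_block k i - S) \<union> free_blocks k S) \<subseteq> carrier (poly_ring d k)"
    if "i \<in> {1..2}" for i
    using minors fb rb[OF that] by blast
  then have H: "minors d t ((row_block k 1 - S) \<union> free_blocks k S) \<subseteq> carrier (poly_ring d k)"
      "minors d t ((row_block k 2 - S) \<union> free_blocks k S) \<subseteq> carrier (poly_ring d k)"
    by simp_all
  have B: "(\<Union>j \<in> J. minors d 2 (col_block j)) \<subseteq> carrier (poly_ring d k)" if "J \<subseteq> {1..k}" for J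
    using that minors sub by blast
  show ?thesis
  proof (cases "S = {}")
    case True
    then show ?thesis
      using B[OF subset_refl] minors[of "columns k" t] by (simp add: gens_F_def)
  next
    case False
    then show ?thesis
      using B[OF Collect_restrict, of "\<lambda>j. col_block j \<inter> S = {}"] minors[OF assms, of 1] G H
      by (simp only: gens_F_def if_False Un_subset_iff simp_thms)
  qed
qed

text \<open>
  The minimal decomposition of the ideal generated by the 2-minors of the matrices on the column
  sets \<^term>\<open>col_block j\<close> and the \<open>t\<close>-minors of those on \<^term>\<open>row_block k i\<close> writes its radical
  as the intersection of the radicals of the \<^term>\<open>ideal_I d k t S\<close>, where \<open>S\<close> ranges over
  \<open>min_decomp_index d k t\<close>. Minimality refers to the ideals themselves, not to the sets \<open>S\<close> or
  to the radicals.
\<close>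

definition min_decomp_index :: "nat \<Rightarrow> nat \<Rightarrow> nat \<Rightarrow> column set set" where
  "min_decomp_index d k t =
     {S. S \<subseteq> columns k \<and> \<not> (\<exists>S' \<subseteq> columns k. ideal_I d k t S' \<subset> ideal_I d k t S)}"

definition comb_type :: "nat \<Rightarrow> column set \<Rightarrow> nat \<times> nat" where
  "comb_type k S =
     (min (card (row_block k 1 \<inter> S)) (card (row_block k 2 \<inter> S)),
      max (card (row_block k 1 \<inter> S)) (card (row_block k 2 \<inter> S)))"

definition num_comb_types :: "nat \<Rightarrow> nat \<Rightarrow> nat \<Rightarrow> nat" where
  "num_comb_types d k t =
     card (comb_type k ` {S \<in> min_decomp_index d k t. \<forall>j \<in> {1..k}. \<not> col_block j \<subseteq> S})"

end

theory Submission
  imports Defs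
begin

text \<open>
  Identify a column set \<open>S\<close> containing no \<^term>\<open>col_block j\<close> with the two disjoint sets
  \<open>S `` {1}\<close> and \<open>S `` {2}\<close> of second indices that it uses in the rows of the column grid, and
  call \<open>j\<close> free if it lies in neither. The heart of the proof (\<open>min_decomp_index_iff\<close>) is that
  \<open>ideal_I d k t S\<close> is minimal iff \<open>S = {}\<close>, or both sets are nonempty and have at most
  \<open>k + 1 - t\<close> elements and, when \<open>t = 2\<close>, nothing is free.

  Inclusions \<open>ideal_I d k t S' \<subseteq> ideal_I d k t S\<close> come from the fact that a minor lies in an ideal as
  soon as all minors on some of its columns do, by Laplace expansion (\<open>minor_in_ideal\<close>). Hence a
  minor lies in \<open>ideal_I d k t S\<close> if it uses a column of \<open>S\<close> or if it uses two columns with the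
  same free second index, and the pigeonhole principle provides two such columns whenever there
  are fewer second indices than columns. So if \<open>S \<noteq> {}\<close> and one of the two
  sets is empty, the ideal of \<open>{}\<close> is strictly smaller; if both are nonempty and one has more than
  \<open>k + 1 - t\<close> elements, the ideal of \<open>S\<close> minus one column of that row is. If both are nonempty,
  \<open>t = 2\<close> and some \<open>j\<close> is free, the ideal already contains every variable of a free column, and
  adding \<open>(1, j)\<close> to \<open>S\<close> makes it smaller.

  Non-inclusions are certified by points. Only matrices whose columns are zero or standard unit
  vectors are needed, because the rank of such a matrix is the number of distinct unit vectors in
  it. For \<open>S\<close> satisfying the criterion, matrices with a single nonzero entry show that
  \<open>ideal_I d k t S' \<subseteq> ideal_I d k t S\<close> forces \<open>S' \<subseteq> S\<close>. If \<open>(i, l) \<in> S - S'\<close>, choose besides \<open>l\<close>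
  some \<open>t - 1\<close> second indices outside \<open>S `` {i}\<close>, among them an element of the other set; this is
  possible as \<open>S `` {i}\<close> has at most \<open>k + 1 - t\<close> elements. Let each of these \<open>t\<close> indices have
  its own unit vector, shared by the columns over it outside \<open>S\<close>, and let all other columns be zero.
  This is a zero of \<open>ideal_I d k t S\<close>: a block contains at most one unit vector, a matrix that must
  have rank less than \<open>t\<close> misses the vector of an index of one set, and the free columns miss one
  of each set. But a \<open>t\<close>-minor in \<open>ideal_I d k t S'\<close> does not vanish there.

  It remains to count: besides \<open>(0, 0)\<close>, the types are the pairs \<open>1 \<le> u \<le> v \<le> k + 1 - t\<close> with
  \<open>u + v \<le> k\<close>, and with \<open>u + v = k\<close> if \<open>t = 2\<close>. Whether \<open>u + v \<le> k\<close> follows from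
  \<open>v \<le> k + 1 - t\<close> is the distinction between \<open>t - 1 \<ge> k / 2\<close> and \<open>t - 1 < k / 2\<close>.
\<close>

section \<open>Evaluating polynomials at a point\<close>

definition monomial_value :: "('v \<Rightarrow> complex) \<Rightarrow> ('v \<Rightarrow>\<^sub>0 nat) \<Rightarrow> complex" where
  "monomial_value P m = (\<Prod>v \<in> Poly_Mapping.keys m. P v ^ Poly_Mapping.lookup m v)"

definition evaluate :: "('v \<Rightarrow> complex) \<Rightarrow> (('v \<Rightarrow>\<^sub>0 nat) \<Rightarrow>\<^sub>0 complex) \<Rightarrow> complex" where
  "evaluate P p = (\<Sum>m \<in> Poly_Mapping.keys p. Poly_Mapping.lookup p m * monomial_value P m)"

lemma monomial_value_superset:
  assumes "finite V" "Poly_Mapping.keys m \<subseteq> V"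
  shows "monomial_value P m = (\<Prod>v \<in> V. P v ^ Poly_Mapping.lookup m v)"
  unfolding monomial_value_def using assms
  by (intro prod.mono_neutral_left) (auto simp: in_keys_iff)

lemma monomial_value_add: "monomial_value P (m + n) = monomial_value P m * monomial_value P n"
proof -
  define V where "V = Poly_Mapping.keys m \<union> Poly_Mapping.keys n"
  have "finite V" "Poly_Mapping.keys m \<subseteq> V" "Poly_Mapping.keys n \<subseteq> V"
      "Poly_Mapping.keys (m + n) \<subseteq> V"
    using Poly_Mapping.keys_add[of m n] by (auto simp: V_def)
  then show ?thesis
    by (simp add: monomial_value_superset[of V] lookup_add power_add prod.distrib)
qed

lemma evaluate_add: "evaluate P (p + q) = evaluate P p + evaluate P q"
  unfolding evaluate_def
  by (rule setsum_keys_plus_distrib) (simp_all add: distrib_right)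

lemma evaluate_zero [simp]: "evaluate P 0 = 0"
  by (simp add: evaluate_def)

lemma evaluate_sum: "evaluate P (sum f A) = (\<Sum>a \<in> A. evaluate P (f a))"
  by (induction A rule: infinite_finite_induct) (simp_all add: evaluate_add)

lemma evaluate_single [simp]: "evaluate P (Poly_Mapping.single m c) = c * monomial_value P m"
  by (simp add: evaluate_def)

lemma sum_of_monomials:
  "p = (\<Sum>m \<in> Poly_Mapping.keys p. Poly_Mapping.single m (Poly_Mapping.lookup p m))"
  by (rule poly_mapping_eqI) (auto simp: lookup_sum lookup_single when_def in_keys_iff)

lemma evaluate_mult: "evaluate P (p * q) = evaluate P p * evaluate P q"
proof -
  let ?s = "\<lambda>p m. Poly_Mapping.single m (Poly_Mapping.lookup p m) :: ('a \<Rightarrow>\<^sub>0 nat) \<Rightarrow>\<^sub>0 complex"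
  have "p * q = (\<Sum>m \<in> Poly_Mapping.keys p. \<Sum>n \<in> Poly_Mapping.keys q. ?s p m * ?s q n)"
    by (subst sum_of_monomials[of p], subst sum_of_monomials[of q]) (rule sum_product)
  also have "evaluate P \<dots> = (\<Sum>m \<in> Poly_Mapping.keys p. \<Sum>n \<in> Poly_Mapping.keys q.
      (Poly_Mapping.lookup p m * monomial_value P m) * (Poly_Mapping.lookup q n * monomial_value P n))"
    by (simp add: evaluate_sum mult_single monomial_value_add mult_ac)
  also have "\<dots> = evaluate P p * evaluate P q"
    by (simp add: evaluate_def sum_product)
  finally show ?thesis .
qed

lemma evaluate_one [simp]: "evaluate P 1 = 1"
  by (simp flip: single_one add: monomial_value_def)

lemma evaluate_hom: "comm_ring_hom (evaluate P)"
  by unfold_locales (simp_all add: evaluate_add evaluate_mult)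

lemma evaluate_indet: "evaluate P (indet i c) = P (i, c)"
  by (simp add: indet_def monomial_value_def)

lemma evaluate_minor:
  assumes "card I = card J"
  shows "evaluate P (minor I J) = det (mat (card J) (card J)
     (\<lambda>(a, b). P (sorted_list_of_set I ! a, sorted_list_of_set J ! b)))"
proof -
  interpret comm_ring_hom "evaluate P" by (rule evaluate_hom)
  show ?thesis
    unfolding minor_def assms hom_det[symmetric]
    by (rule arg_cong[where f = det]) (auto simp: evaluate_indet)
qed

text \<open>
  The polynomials vanishing at a point form an ideal, so one point at which all generators vanish
  excludes every polynomial with a nonzero value there from \<^term>\<open>ideal_I d k t S\<close>.
\<close>

lemma evaluate_ideal_I:
  assumes "S \<subseteq> columns k" and "\<And>q. q \<in> gens_F d k t S \<Longrightarrow> evaluate P q = 0"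
    and "p \<in> ideal_I d k t S"
  shows "evaluate P p = 0"
proof -
  interpret cring "poly_ring d k" by (rule cring_poly_ring)
  let ?Z = "{p \<in> carrier (poly_ring d k). evaluate P p = 0}"
  have ops: "p \<oplus>\<^bsub>poly_ring d k\<^esub> q = p + q" "p \<otimes>\<^bsub>poly_ring d k\<^esub> q = p * q"
      "\<zero>\<^bsub>poly_ring d k\<^esub> = 0" for p q
    by (simp_all add: poly_ring_def)
  have neg: "\<ominus>\<^bsub>poly_ring d k\<^esub> p = - p" if "p \<in> carrier (poly_ring d k)" for p
    using that by (intro minus_equality) (simp_all add: ops, simp_all add: poly_ring_def)
  have "ideal ?Z (poly_ring d k)"
  proof (rule idealI)
    show "subgroup ?Z (add_monoid (poly_ring d k))"
    proof (rule add.subgroupI)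
      fix p assume p: "p \<in> ?Z"
      interpret comm_ring_hom "evaluate P" by (rule evaluate_hom)
      from p show "\<ominus>\<^bsub>poly_ring d k\<^esub> p \<in> ?Z"
        using a_inv_closed[of p] by (simp add: neg hom_uminus)
    next
      fix p q assume "p \<in> ?Z" "q \<in> ?Z"
      then show "p \<oplus>\<^bsub>poly_ring d k\<^esub> q \<in> ?Z"
        using a_closed[of p q] by (simp add: ops evaluate_add)
    qed (use zero_closed in \<open>auto simp: ops\<close>)
  next
    fix p x assume p: "p \<in> ?Z" and x: "x \<in> carrier (poly_ring d k)"
    then show "x \<otimes>\<^bsub>poly_ring d k\<^esub> p \<in> ?Z" "p \<otimes>\<^bsub>poly_ring d k\<^esub> x \<in> ?Z"
      using m_closed[of x p] m_closed[of p x] by (simp_all add: ops evaluate_mult)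
  qed (rule ring_axioms)
  then have "ideal_I d k t S \<subseteq> ?Z"
    unfolding ideal_I_def
    using assms(2) gens_F_in_poly_ring[OF assms(1)] by (intro genideal_minimal) auto
  with assms(3) show ?thesis by blast
qed

section \<open>Minors at matrices of unit vectors\<close>

text \<open>
  Column \<open>c\<close> is the standard unit vector with index \<open>\<sigma> c\<close>. Rows are numbered from 1, so
  \<open>\<sigma> c = 0\<close> encodes a zero column.
\<close>

definition unit_point :: "(column \<Rightarrow> nat) \<Rightarrow> nat \<times> column \<Rightarrow> complex" where
  "unit_point \<sigma> = (\<lambda>(i, c). if i = \<sigma> c then 1 else 0)"

text \<open>
  Fewer nonzero unit vectors than columns: some column is zero, or two columns coincide.
\<close>

lemma minor_unit_point_eq_0:
  assumes I: "I \<subseteq> {1..d}" and J: "finite J" and IJ: "card I = card J"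
    and W: "finite W" "\<sigma> ` J \<subseteq> insert 0 W" "card W < card J"
  shows "evaluate (unit_point \<sigma>) (minor I J) = 0"
proof -
  let ?is = "sorted_list_of_set I" and ?js = "sorted_list_of_set J"
  define n where "n = card J"
  define A where "A = mat n n (\<lambda>(a, b). unit_point \<sigma> (?is ! a, ?js ! b))"
  have A: "A \<in> carrier_mat n n" by (simp add: A_def)
  have eq: "evaluate (unit_point \<sigma>) (minor I J) = det A"
    by (simp add: evaluate_minor[OF IJ] A_def n_def)
  have index: "\<exists>b<n. ?js ! b = c" if "c \<in> J" for c
  proof -
    from that J have "c \<in> set ?js" by simp
    then show ?thesis unfolding in_set_conv_nth by (simp add: n_def)
  qed
  have pos: "?is ! a \<noteq> 0" if "a < n" for a
  proof -
    have "?is ! a \<in> I"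
      using that IJ finite_subset[OF I] nth_mem[of a ?is] by (simp add: n_def)
    with I have "?is ! a \<in> {1..d}" by blast
    then show ?thesis by simp
  qed
  show ?thesis
  proof (cases "0 \<in> \<sigma> ` J")
    case True
    then obtain c where "c \<in> J" "\<sigma> c = 0" by auto
    then obtain b where b: "b < n" "\<sigma> (?js ! b) = 0" using index[of c] by auto
    have "det A = (\<Sum>a<n. A $$ (a, b) * cofactor A a b)"
      by (rule laplace_expansion_column[OF A b(1)])
    also have "\<dots> = 0"
    proof (intro sum.neutral ballI)
      fix a assume "a \<in> {..<n}"
      then have "A $$ (a, b) = 0"
        using b pos[of a] by (simp add: A_def unit_point_def)
      then show "A $$ (a, b) * cofactor A a b = 0" by simp
    qed
    finally show ?thesis by (simp add: eq)
  next
    case False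
    with W(2) have "\<sigma> ` J \<subseteq> W" by (simp add: subset_insert)
    then have "card (\<sigma> ` J) < card J"
      using card_mono[OF W(1), of "\<sigma> ` J"] W(3) by linarith
    then have "\<not> inj_on \<sigma> J" by (rule pigeonhole)
    then obtain c c' where "c \<in> J" "c' \<in> J" "c \<noteq> c'" "\<sigma> c = \<sigma> c'"
      by (auto simp: inj_on_def)
    moreover obtain b b' where "b < n" "b' < n" "?js ! b = c" "?js ! b' = c'"
      using index[OF \<open>c \<in> J\<close>] index[OF \<open>c' \<in> J\<close>] by blast
    ultimately have b: "b < n" "b' < n" "b \<noteq> b'" "\<sigma> (?js ! b) = \<sigma> (?js ! b')"
      by blast+
    then have "col A b = col A b'"
      by (intro eq_vecI) (auto simp: A_def unit_point_def)
    then have "det A = 0"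
      using det_identical_columns[OF A b(3,1,2)] by simp
    then show ?thesis by (simp add: eq)
  qed
qed

lemma minors_unit_point_eq_0:
  assumes "q \<in> minors d r U" and "finite W" "\<sigma> ` U \<subseteq> insert 0 W" "card W < r"
  shows "evaluate (unit_point \<sigma>) q = 0"
proof -
  from assms(1) obtain I J where q: "q = minor I J" "I \<subseteq> {1..d}" "J \<subseteq> U" "card I = r" "card J = r"
    by (auto simp: minors_def)
  with assms(4) have "finite J" by (intro card_ge_0_finite) linarith
  then show ?thesis
    unfolding q(1) using q assms(2,4) subset_trans[OF image_mono[OF q(3)] assms(3)]
    by (intro minor_unit_point_eq_0[of I d J W]) simp_all
qed

text \<open>
  The matrix is a permutation matrix, so its transpose is its inverse.
\<close>

lemma minor_unit_point_neq_0:
  assumes J: "finite J" and inj: "inj_on \<sigma> J"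
  shows "evaluate (unit_point \<sigma>) (minor (\<sigma> ` J) J) \<noteq> 0"
proof -
  let ?is = "sorted_list_of_set (\<sigma> ` J)" and ?js = "sorted_list_of_set J"
  define n where "n = card J"
  define A where "A = mat n n (\<lambda>(a, b). unit_point \<sigma> (?is ! a, ?js ! b))"
  have A: "A \<in> carrier_mat n n" by (simp add: A_def)
  have card: "card (\<sigma> ` J) = card J" using inj by (rule card_image)
  have eq: "evaluate (unit_point \<sigma>) (minor (\<sigma> ` J) J) = det A"
    by (simp add: evaluate_minor[OF card] A_def n_def)
  have bij: "bij_betw ((!) ?is) {0..<n} (\<sigma> ` J)"
    using J card by (intro bij_betw_nth) (auto simp: n_def)
  have "A\<^sup>T * A = 1\<^sub>m n"
  proof (rule eq_matI)
    fix b b' assume "b < dim_row (1\<^sub>m n)" "b' < dim_col (1\<^sub>m n)"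
    then have b: "b < n" "b' < n" by simp_all
    have mem: "?js ! b \<in> J" "?js ! b' \<in> J"
      using b J nth_mem[of _ ?js] by (simp_all add: n_def)
    have "(A\<^sup>T * A) $$ (b, b') = (\<Sum>a = 0..<n. A $$ (a, b) * A $$ (a, b'))"
      using A b by (simp add: scalar_prod_def)
    also have "\<dots> = (\<Sum>a = 0..<n. (\<lambda>i. unit_point \<sigma> (i, ?js ! b) * unit_point \<sigma> (i, ?js ! b')) (?is ! a))"
      using b by (intro sum.cong) (simp_all add: A_def)
    also have "\<dots> = (\<Sum>i \<in> \<sigma> ` J. unit_point \<sigma> (i, ?js ! b) * unit_point \<sigma> (i, ?js ! b'))"
      by (rule sum.reindex_bij_betw[OF bij])
    also have "\<dots> = (\<Sum>i \<in> \<sigma> ` J. if i = \<sigma> (?js ! b) then (if b = b' then 1 else 0) else 0)"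
    proof (rule sum.cong)
      fix i
      have "?js ! b = ?js ! b' \<longleftrightarrow> b = b'"
        using b J by (intro nth_eq_iff_index_eq) (simp_all add: n_def)
      then have "\<sigma> (?js ! b) = \<sigma> (?js ! b') \<longleftrightarrow> b = b'"
        using inj mem by (metis inj_on_def)
      then show "unit_point \<sigma> (i, ?js ! b) * unit_point \<sigma> (i, ?js ! b') =
          (if i = \<sigma> (?js ! b) then (if b = b' then 1 else 0) else 0)"
        by (auto simp: unit_point_def)
    qed simp
    also have "\<dots> = (if b = b' then 1 else 0)"
      using J mem by simp
    finally show "(A\<^sup>T * A) $$ (b, b') = 1\<^sub>m n $$ (b, b')"
      using b by simp
  qed (use A in auto)
  then have "det (A\<^sup>T) * det A = 1"
    using A det_mult[of "A\<^sup>T" n A] by (simp add: det_one)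
  then have "det A \<noteq> 0" by auto
  then show ?thesis by (simp add: eq)
qed

section \<open>Minors in an ideal\<close>

lemma nth_remove1:
  assumes "distinct xs" "i < length xs" "a < length xs - 1"
  shows "remove1 (xs ! i) xs ! a = xs ! insert_index i a"
proof -
  have xs: "xs = take i xs @ xs ! i # drop (Suc i) xs"
    using assms by (simp add: id_take_nth_drop)
  have "xs ! i \<notin> set (take i xs)"
    using assms by (auto simp: in_set_conv_nth nth_eq_iff_index_eq)
  then have "remove1 (xs ! i) xs = take i xs @ drop (Suc i) xs"
    by (subst (2) xs) (simp add: remove1_append)
  then show ?thesis
    using assms by (auto simp: nth_append insert_index_def)
qed

text \<open>
  Expansion along the column \<open>c\<close>. The existentially quantified signs depend on the positions of
  the row and of \<open>c\<close> in the sorted index sets, which the applications do not need to know.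
\<close>

lemma minor_laplace:
  assumes I: "finite I" and J: "finite J" and IJ: "card I = card J" and c: "c \<in> J"
  shows "\<exists>s. (\<forall>i. s i \<in> {1, -1}) \<and>
    minor I J = (\<Sum>i \<in> I. s i * indet i c * minor (I - {i}) (J - {c}))"
proof -
  let ?is = "sorted_list_of_set I" and ?js = "sorted_list_of_set J"
  define n where "n = card J"
  define A where "A = mat n n (\<lambda>(a, b). indet (?is ! a) (?js ! b))"
  obtain b where b: "b < n" "?js ! b = c"
    using c J by (metis in_set_conv_nth n_def set_sorted_list_of_set length_sorted_list_of_set)
  have A: "A \<in> carrier_mat n n" by (simp add: A_def)
  have del: "det (mat_delete A a b) = minor (I - {?is ! a}) (J - {c})" if a: "a < n" for a
  proof -
    have mem: "?is ! a \<in> I"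
      using a IJ I nth_mem[of a ?is] by (simp add: n_def)
    have card: "card (I - {?is ! a}) = n - 1" "card (J - {c}) = n - 1"
      using mem c I J IJ by (simp_all add: n_def)
    have rows: "sorted_list_of_set (I - {?is ! a}) ! x = ?is ! insert_index a x" if "x < n - 1" for x
      using that a I IJ by (subst sorted_list_of_set_remove) (simp_all add: nth_remove1 n_def)
    have cols: "sorted_list_of_set (J - {c}) ! x = ?js ! insert_index b x" if "x < n - 1" for x
      using that b J
      by (subst sorted_list_of_set_remove) (simp_all add: nth_remove1 n_def flip: b(2))
    have "mat_delete A a b = mat (card (I - {?is ! a})) (card (J - {c}))
        (\<lambda>(x, y). indet (sorted_list_of_set (I - {?is ! a}) ! x) (sorted_list_of_set (J - {c}) ! y))"
      unfolding card mat_delete_def using a b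
      by (intro eq_matI) (auto simp: A_def rows cols insert_index_def)
    then show ?thesis by (simp add: minor_def)
  qed
  define f where "f = the_inv_into {..<n} ((!) ?is)"
  have bij: "bij_betw ((!) ?is) {..<n} I"
    using I IJ by (intro bij_betw_nth) (simp_all add: n_def)
  have "minor I J = (\<Sum>a<n. A $$ (a, b) * cofactor A a b)"
    unfolding minor_def IJ A_def[symmetric] n_def[symmetric]
    by (rule laplace_expansion_column[OF A b(1)])
  also have "\<dots> = (\<Sum>a<n. (\<lambda>i. (-1) ^ (f i + b) * indet i c * minor (I - {i}) (J - {c})) (?is ! a))"
  proof (rule sum.cong)
    fix a assume a: "a \<in> {..<n}"
    then have "f (?is ! a) = a"
      using bij by (simp add: f_def bij_betw_def the_inv_into_f_f)
    moreover have "A $$ (a, b) = indet (?is ! a) c"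
      using a b by (simp add: A_def)
    ultimately show "A $$ (a, b) * cofactor A a b =
        (\<lambda>i. (-1) ^ (f i + b) * indet i c * minor (I - {i}) (J - {c})) (?is ! a)"
      using a by (simp add: cofactor_def del mult_ac)
  qed simp
  also have "\<dots> = (\<Sum>i \<in> I. (-1) ^ (f i + b) * indet i c * minor (I - {i}) (J - {c}))"
    by (rule sum.reindex_bij_betw[OF bij])
  finally show ?thesis
    by (intro exI[of _ "\<lambda>i. (-1) ^ (f i + b)"]) (simp add: minus_one_power_iff)
qed

text \<open>
  Expanding along the columns outside \<open>K\<close>, one after the other, writes the minor as a linear
  combination of minors with column set \<open>K\<close>. The relevant cases are a single column of \<open>S\<close>, where
  these minors are variables, and a whole block \<^term>\<open>col_block j\<close>, where they are 2-minors.
\<close>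

lemma minor_in_ideal:
  assumes Q: "ideal Q (poly_ring d k)"
    and K: "K \<subseteq> J" and mK: "minors d (card K) K \<subseteq> Q"
    and J: "J \<subseteq> columns k" and I: "I \<subseteq> {1..d}" and IJ: "card I = card J"
  shows "minor I J \<in> Q"
proof -
  interpret Q: ideal Q "poly_ring d k" by (rule Q)
  have add: "p + q \<in> Q" if "p \<in> Q" "q \<in> Q" for p q
    using additive_subgroup.a_closed[OF Q.is_additive_subgroup that] by (simp add: poly_ring_def)
  have mult: "x * p \<in> Q" if "p \<in> Q" "x \<in> carrier (poly_ring d k)" for x p
    using Q.I_l_closed[OF that] by (simp add: poly_ring_def)
  have zero: "0 \<in> Q"
    using additive_subgroup.zero_closed[OF Q.is_additive_subgroup] by (simp add: poly_ring_def)
  have sum: "sum f A \<in> Q" if "\<And>a. a \<in> A \<Longrightarrow> f a \<in> Q" for f and A :: "nat set"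
    using that by (induction A rule: infinite_finite_induct) (auto simp: zero add)
  show ?thesis
    using K J I IJ
  proof (induction "card (J - K)" arbitrary: I J)
    case 0
    have "finite J"
      using finite_subset[OF \<open>J \<subseteq> columns k\<close>] by (simp add: columns_def)
    with 0 have "J = K" by auto
    then have "minor I J \<in> minors d (card K) K"
      using 0 unfolding minors_def by blast
    with mK show ?case by blast
  next
    case (Suc n)
    have finJ: "finite J"
      using finite_subset[OF \<open>J \<subseteq> columns k\<close>] by (simp add: columns_def)
    have finI: "finite I" using finite_subset[OF \<open>I \<subseteq> {1..d}\<close>] by simp
    from Suc.hyps(2) have "J - K \<noteq> {}" by (metis card.empty nat.distinct(1))
    then obtain c where c: "c \<in> J" "c \<notin> K" by blast
    obtain s where s: "minor I J = (\<Sum>i \<in> I. s i * indet i c * minor (I - {i}) (J - {c}))"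
        and s1: "\<And>i. s i \<in> {1, -1}"
      using minor_laplace[OF finI finJ \<open>card I = card J\<close> c(1)] by blast
    have "s i * indet i c * minor (I - {i}) (J - {c}) \<in> Q" if i: "i \<in> I" for i
    proof (rule mult)
      have "n = card (J - {c} - K)"
      proof -
        have "J - {c} - K = J - K - {c}" by auto
        then show ?thesis using Suc.hyps(2)[symmetric] c finJ by simp
      qed
      moreover have "card (I - {i}) = card (J - {c})"
        using i c finI finJ Suc.prems by simp
      ultimately show "minor (I - {i}) (J - {c}) \<in> Q"
        using Suc.prems c by (intro Suc.hyps(1)) auto
      show "s i * indet i c \<in> carrier (poly_ring d k)"
        using s1[of i] c i Suc.prems by (auto simp: poly_ring_def indet_def)
    qed
    then show ?case unfolding s by (rule sum)
  qed
qed

lemma minors_mono: "U \<subseteq> V \<Longrightarrow> minors d r U \<subseteq> minors d r V"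
  unfolding minors_def by blast

lemma indet_in_minors:
  assumes "c \<in> U" "i \<in> {1..d}"
  shows "indet i c \<in> minors d 1 U"
proof -
  have "minor {i} {c} = indet i c"
    by (simp add: minor_def det_single)
  moreover have "minor {i} {c} \<in> minors d 1 U"
    using assms unfolding minors_def by fastforce
  ultimately show ?thesis by simp
qed

section \<open>The index sets and their generators\<close>

lemma row_block_subset_columns: "i \<in> {1..2} \<Longrightarrow> row_block k i \<subseteq> columns k"
  unfolding row_block_def columns_def by (intro Sigma_mono) simp_all

lemma row_indices_subset:
  assumes "S \<subseteq> columns k"
  shows "S `` {i} \<subseteq> {1..k}"
proof
  fix j assume "j \<in> S `` {i}"
  then have "(i, j) \<in> S" by simp
  with assms have "(i, j) \<in> columns k" by (rule subsetD)
  then show "j \<in> {1..k}" by (simp add: columns_def)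
qed

lemma block_disjoint:
  assumes "S \<subseteq> columns k" "\<forall>j \<in> {1..k}. \<not> col_block j \<subseteq> S"
    and "i \<in> {1..2}" "(i, j) \<in> S" "i' \<in> {1..2}" "i' \<noteq> i"
  shows "(i', j) \<notin> S"
proof
  assume "(i', j) \<in> S"
  moreover have "{i, i'} = {1..2}" using assms(3,5,6) by auto
  then have "col_block j = {(i, j), (i', j)}" unfolding col_block_def by blast
  ultimately have "col_block j \<subseteq> S" using assms(4) by simp
  moreover have "j \<in> {1..k}" using assms(1,4) by (auto simp: columns_def)
  ultimately show False using assms(2) by blast
qed

lemma other_row:
  assumes "i \<in> {1..2::nat}"
  obtains i' where "i' \<in> {1..2}" "i' \<noteq> i" "{i, i'} = {1..2}"
proof (rule that[of "3 - i"])
  have two: "{1..2} = {1, 2::nat}" by auto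
  from assms have "i = 1 \<or> i = 2" unfolding two by simp
  then show "3 - i \<in> {1..2}" "3 - i \<noteq> i" "{i, 3 - i} = {1..2}"
    unfolding two by (elim disjE; simp add: insert_commute)+
qed

lemma row_mem_cases:
  assumes "S \<subseteq> columns k" "j \<in> snd ` S" "{i, i'} = {1..2}"
  shows "(i, j) \<in> S \<or> (i', j) \<in> S"
proof -
  from assms(2) obtain m where m: "(m, j) \<in> S" by auto
  with assms(1) have "m \<in> {1..2}" by (auto simp: columns_def)
  then have "m = i \<or> m = i'" unfolding assms(3)[symmetric] by blast
  with m show ?thesis by blast
qed

lemma free_blocks_eq:
  assumes "S \<subseteq> columns k"
  shows "free_blocks k S = {1..2} \<times> ({1..k} - snd ` S)"
  using assms by (force simp: free_blocks_def col_block_def columns_def)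

lemma free_blocks_subset_columns: "S \<subseteq> columns k \<Longrightarrow> free_blocks k S \<subseteq> columns k"
  unfolding free_blocks_eq unfolding columns_def by (intro Sigma_mono) simp_all

lemma gens_F_nonempty:
  assumes "S \<subseteq> columns k" "S \<noteq> {}"
  shows "gens_F d k t S = minors d 1 S \<union> (\<Union>j \<in> {1..k} - snd ` S. minors d 2 (col_block j))
    \<union> gens_G d k t S \<union> (\<Union>i \<in> {1..2}. minors d t (row_block k i - S \<union> free_blocks k S))"
proof -
  have 1: "{j \<in> {1..k}. col_block j \<inter> S = {}} = {1..k} - snd ` S"
    using assms(1) by (force simp: col_block_def columns_def)
  have 2: "{1..2} = {1, 2 :: nat}" by auto
  show ?thesis
    using assms(2) unfolding gens_F_def 1 2 by auto
qed

lemma gens_G_subset: "gens_G d k t S \<subseteq> minors d (t - 1) (free_blocks k S)"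
  by (simp add: gens_G_def)

text \<open>
  Without a full block in \<open>S\<close>, the case distinction in \<^const>\<open>gens_G\<close> is whether \<open>S\<close> meets both
  row blocks.
\<close>

lemma gens_G_eq_minors:
  assumes "S \<subseteq> columns k" "\<forall>j \<in> {1..k}. \<not> col_block j \<subseteq> S"
    and "\<And>i. i \<in> {1..2} \<Longrightarrow> S `` {i} \<noteq> {}"
  shows "gens_G d k t S = minors d (t - 1) (free_blocks k S)"
proof -
  obtain \<alpha> \<beta> where ab: "(1, \<alpha>) \<in> S" "(2, \<beta>) \<in> S"
    using assms(3)[of 1] assms(3)[of 2] by auto
  then have "(2, \<alpha>) \<notin> S" "(1, \<beta>) \<notin> S"
    using block_disjoint[OF assms(1,2), of 1 \<alpha> 2] block_disjoint[OF assms(1,2), of 2 \<beta> 1] by simp_all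
  moreover have "\<alpha> \<in> {1..k}" "\<beta> \<in> {1..k}" using ab assms(1) by (auto simp: columns_def)
  ultimately show ?thesis using ab unfolding gens_G_def by auto
qed

lemma gens_F_subset_ideal_I:
  assumes "S \<subseteq> columns k"
  shows "gens_F d k t S \<subseteq> ideal_I d k t S"
proof -
  interpret cring "poly_ring d k" by (rule cring_poly_ring)
  show ?thesis
    unfolding ideal_I_def by (rule genideal_self[OF gens_F_in_poly_ring[OF assms]])
qed

lemma ideal_I_is_ideal:
  assumes "S \<subseteq> columns k"
  shows "ideal (ideal_I d k t S) (poly_ring d k)"
proof -
  interpret cring "poly_ring d k" by (rule cring_poly_ring)
  show ?thesis
    unfolding ideal_I_def by (rule genideal_ideal[OF gens_F_in_poly_ring[OF assms]])
qed

lemma ideal_I_subsetI: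
  assumes "S \<subseteq> columns k" and "gens_F d k t S' \<subseteq> ideal_I d k t S"
  shows "ideal_I d k t S' \<subseteq> ideal_I d k t S"
proof -
  interpret cring "poly_ring d k" by (rule cring_poly_ring)
  show ?thesis
    unfolding ideal_I_def[of d k t S']
    by (rule genideal_minimal[OF ideal_I_is_ideal[OF assms(1)] assms(2)])
qed

lemma indet_in_ideal_I:
  assumes "S \<subseteq> columns k" "c \<in> S" "i \<in> {1..d}"
  shows "indet i c \<in> ideal_I d k t S"
proof -
  have "indet i c \<in> gens_F d k t S"
    using indet_in_minors[OF assms(2,3)] assms(1,2) gens_F_nonempty[of S k] by blast
  then show ?thesis using gens_F_subset_ideal_I[OF assms(1)] by blast
qed

section \<open>Polynomials outside the ideals\<close>

text \<open>
  At the matrix whose only nonzero entry is the one at \<open>(i, c)\<close>, every minor of size at least 2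
  vanishes. The alternatives in the last hypothesis exclude the only case in which further variables
  can be among the generators: for \<open>t = 2\<close> the set \<^const>\<open>gens_G\<close> consists of 1-minors of free columns.
\<close>

lemma indet_notin_ideal_I:
  assumes S: "S \<subseteq> columns k" "c \<notin> S" and i: "1 \<le> i" and t: "2 \<le> t"
    and free: "S = {} \<or> 3 \<le> t \<or> c \<notin> free_blocks k S"
  shows "indet i c \<notin> ideal_I d k t S"
proof
  assume mem: "indet i c \<in> ideal_I d k t S"
  define \<sigma> where "\<sigma> = (\<lambda>c'. if c' = c then i else 0)"
  have vanish: "evaluate (unit_point \<sigma>) q = 0" if "q \<in> minors d r U" "2 \<le> r \<or> c \<notin> U \<and> 1 \<le> r" for q r U
    using that(2)
  proof
    assume "2 \<le> r"
    with that(1) show ?thesis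
      by (intro minors_unit_point_eq_0[of q d r U "{i}"]) (auto simp: \<sigma>_def)
  next
    assume "c \<notin> U \<and> 1 \<le> r"
    with that(1) show ?thesis
      by (intro minors_unit_point_eq_0[of q d r U "{}"]) (auto simp: \<sigma>_def)
  qed
  have "evaluate (unit_point \<sigma>) q = 0" if q: "q \<in> gens_F d k t S" for q
  proof (cases "S = {}")
    case True
    then consider j where "q \<in> minors d 2 (col_block j)" | "q \<in> minors d t (columns k)"
      using q by (auto simp: gens_F_def)
    then show ?thesis
      by cases (rule vanish, assumption, use t in simp)+
  next
    case False
    from q consider "q \<in> minors d 1 S" | j where "q \<in> minors d 2 (col_block j)"
      | "q \<in> gens_G d k t S" | i where "q \<in> minors d t (row_block k i - S \<union> free_blocks k S)"
      unfolding gens_F_nonempty[OF S(1) False] by blast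
    then show ?thesis
    proof cases
      case 1
      then show ?thesis by (rule vanish) (use S in simp)
    next
      case 2
      then show ?thesis by (rule vanish) simp
    next
      case 3
      then have "q \<in> minors d (t - 1) (free_blocks k S)" using gens_G_subset by blast
      then show ?thesis by (rule vanish) (use t free False in auto)
    next
      case 4
      then show ?thesis by (rule vanish) (use t in simp)
    qed
  qed
  from evaluate_ideal_I[OF S(1) this mem] have "unit_point \<sigma> (i, c) = 0"
    by (simp add: evaluate_indet)
  then show False by (simp add: unit_point_def \<sigma>_def)
qed

text \<open>
  \<open>J\<close> picks \<open>t\<close> columns with different second indices, which form a set \<open>T\<close>. The separating point has one unit vector
  for each \<open>j \<in> T\<close>, shared by all columns with second index \<open>j\<close> outside \<open>S\<close>; all other columns are
  zero. Take \<open>\<alpha> \<in> T\<close> with \<open>(1, \<alpha>) \<in> S\<close> and \<open>\<beta> \<in> T\<close> with \<open>(2, \<beta>) \<in> S\<close>. The unit vector of \<open>\<alpha>\<close> does not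
  occur in \<open>row_block k 1 - S\<close>, that of \<open>\<beta>\<close> does not occur in \<open>row_block k 2 - S\<close>, and neither
  occurs in a free block, so all rank conditions defining \<^term>\<open>ideal_I d k t S\<close> hold.
\<close>

lemma transversal_minors_not_subset:
  assumes S: "S \<subseteq> columns k" and proper: "\<forall>j \<in> {1..k}. \<not> col_block j \<subseteq> S"
    and t: "2 \<le> t" "t \<le> d"
    and T: "snd ` J \<inter> S `` {1} \<noteq> {}" "snd ` J \<inter> S `` {2} \<noteq> {}"
    and J: "J \<subseteq> columns k - S" "inj_on snd J" "card J = t"
  shows "\<not> minors d t J \<subseteq> ideal_I d k t S"
proof
  assume sub: "minors d t J \<subseteq> ideal_I d k t S"
  define T where "T = snd ` J"
  have cT: "card T = t" using J card_image[of snd J] by (simp add: T_def)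
  have finJ: "finite J" using J(3) t by (metis card.infinite not_numeral_le_zero)
  then have finT: "finite T" by (simp add: T_def)
  obtain g where g: "bij_betw g T {1..t}"
    using finite_same_card_bij[OF finT, of "{1..t}"] cT by auto
  define \<sigma> where "\<sigma> c = (if c \<in> columns k - S \<and> snd c \<in> T then g (snd c) else 0)" for c
  from T obtain \<alpha> \<beta> where ab: "\<alpha> \<in> T" "(1, \<alpha>) \<in> S" "\<beta> \<in> T" "(2, \<beta>) \<in> S"
    by (auto simp: T_def)
  have split: "\<not> ((1, j) \<in> S \<and> (2, j) \<in> S)" for j
  proof
    assume *: "(1, j) \<in> S \<and> (2, j) \<in> S"
    then have "j \<in> {1..k}" using S by (auto simp: columns_def)
    moreover have "col_block j = {(1, j), (2, j)}" by (auto simp: col_block_def)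
    then have "col_block j \<subseteq> S" using * by simp
    ultimately show False using proper by blast
  qed
  from ab split have "\<alpha> \<noteq> \<beta>" by auto
  (* T - T' are the indices whose unit vector does not occur in U. *)
  have vanish: "evaluate (unit_point \<sigma>) q = 0"
    if q: "q \<in> minors d r U" and T': "T' \<subseteq> T" "card T' < r" and U: "U \<inter> (columns k - S) \<subseteq> {c. snd c \<notin> T - T'}"
    for q r U T'
  proof (rule minors_unit_point_eq_0[OF q])
    show "finite (g ` T')" using T' finT finite_subset by blast
    show "card (g ` T') < r"
      using T' card_image_le[of T' g] finT by (meson finite_subset le_less_trans)
    show "\<sigma> ` U \<subseteq> insert 0 (g ` T')" using U by (auto simp: \<sigma>_def)
  qed
  have "evaluate (unit_point \<sigma>) q = 0" if q: "q \<in> gens_F d k t S" for q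
  proof -
    have ne: "S \<noteq> {}" using ab by auto
    from q consider "q \<in> minors d 1 S" | j where "q \<in> minors d 2 (col_block j)"
      | "q \<in> gens_G d k t S" | "q \<in> minors d t (row_block k 1 - S \<union> free_blocks k S)"
      | "q \<in> minors d t (row_block k 2 - S \<union> free_blocks k S)"
      unfolding gens_F_def if_not_P[OF ne] by blast
    then show ?thesis
    proof cases
      case 1
      then show ?thesis by (rule vanish[where T' = "{}"]) auto
    next
      case (2 j)
      then show ?thesis
      proof (rule vanish[where T' = "{j} \<inter> T"])
        have "card ({j} \<inter> T) \<le> card {j}" by (rule card_mono) auto
        then show "card ({j} \<inter> T) < 2" by simp
      qed (auto simp: col_block_def)
    next
      case 3
      then have "q \<in> minors d (t - 1) (free_blocks k S)" using gens_G_subset by blast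
      then show ?thesis
      proof (rule vanish[where T' = "T - {\<alpha>, \<beta>}"])
        have "card (T - {\<alpha>, \<beta>}) = t - 2"
          using ab \<open>\<alpha> \<noteq> \<beta>\<close> finT cT by (simp add: card_Diff_subset)
        then show "card (T - {\<alpha>, \<beta>}) < t - 1" using t by simp
      qed (use ab in \<open>force simp: free_blocks_eq[OF S]\<close>)+
    next
      case 4
      then show ?thesis
      proof (rule vanish[where T' = "T - {\<alpha>}"])
        show "card (T - {\<alpha>}) < t" using ab finT cT t by simp
      qed (use ab in \<open>force simp: free_blocks_eq[OF S] row_block_def\<close>)+
    next
      case 5
      then show ?thesis
      proof (rule vanish[where T' = "T - {\<beta>}"])
        show "card (T - {\<beta>}) < t" using ab finT cT t by simp
      qed (use ab in \<open>force simp: free_blocks_eq[OF S] row_block_def\<close>)+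
    qed
  qed
  note van = evaluate_ideal_I[OF S this]
  have \<sigma>J: "\<sigma> c = g (snd c)" if "c \<in> J" for c
    using that J by (auto simp: \<sigma>_def T_def)
  have "\<sigma> ` J = g ` T" using \<sigma>J by (auto simp: T_def)
  then have im: "\<sigma> ` J = {1..t}" using g by (simp add: bij_betw_def)
  then have inj: "inj_on \<sigma> J" using finJ J(3) by (intro eq_card_imp_inj_on) simp_all
  have "minor (\<sigma> ` J) J \<in> minors d t J"
    using t J(3) unfolding minors_def im by force
  with sub van have "evaluate (unit_point \<sigma>) (minor (\<sigma> ` J) J) = 0" by blast
  with minor_unit_point_neq_0[OF finJ inj] show False by contradiction
qed

section \<open>Inclusions between the ideals\<close>

text \<open>
  A criterion that reduces inclusions to counting. Minors using a column of \<open>S\<close> are always in the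
  ideal. A minor avoiding \<open>S\<close> with fewer second indices than columns contains a whole block
  disjoint from \<open>S\<close>, whose 2-minors are generators.
\<close>

lemma minors_subset_ideal_I:
  assumes S: "S \<subseteq> columns k" "S \<noteq> {}" and U: "U \<subseteq> columns k"
    and J: "\<And>J. \<lbrakk>J \<subseteq> U - S; card J = r\<rbrakk> \<Longrightarrow> card (snd ` J) < r \<or>
      r = t \<and> (\<exists>i \<in> {1..2}. J \<subseteq> row_block k i - S \<union> free_blocks k S)"
  shows "minors d r U \<subseteq> ideal_I d k t S"
proof
  fix q assume "q \<in> minors d r U"
  then obtain I J where q: "q = minor I J" "I \<subseteq> {1..d}" "J \<subseteq> U" "card I = r" "card J = r"
    by (auto simp: minors_def)
  have JC: "J \<subseteq> columns k" using q(3) U by blast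
  have contract: "q \<in> ideal_I d k t S"
    if "K \<subseteq> J" "minors d (card K) K \<subseteq> ideal_I d k t S" for K
    unfolding q(1) using q by (intro minor_in_ideal[OF ideal_I_is_ideal[OF S(1)] that JC]) simp_all
  note gens = gens_F_nonempty[OF S, of d t] gens_F_subset_ideal_I[OF S(1), of d t]
  show "q \<in> ideal_I d k t S"
  proof (cases "J \<inter> S = {}")
    case False
    then obtain c where c: "c \<in> J" "c \<in> S" by blast
    have "minors d 1 {c} \<subseteq> ideal_I d k t S"
      using minors_mono[of "{c}" S d 1] c gens by blast
    then show ?thesis using contract[of "{c}"] c by simp
  next
    case True
    with q(3) have "J \<subseteq> U - S" by blast
    from J[OF this q(5)] show ?thesis
    proof (elim disjE conjE bexE)
      assume "card (snd ` J) < r"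
      then have "\<not> inj_on snd J" using q(5) pigeonhole by blast
      then obtain c c' where c: "c \<in> J" "c' \<in> J" "c \<noteq> c'" "snd c = snd c'"
        by (auto simp: inj_on_def)
      define j where "j = snd c"
      have "c \<in> columns k" "c' \<in> columns k" using c JC by blast+
      then have j: "j \<in> {1..k}" and "{fst c, fst c'} = {1..2}"
        using c(3,4) by (auto simp: columns_def j_def prod_eq_iff)
      then have "col_block j = {c, c'}"
        using c(4) by (force simp: col_block_def j_def prod_eq_iff)
      then have cj: "col_block j \<subseteq> J" "card (col_block j) = 2"
        using c by simp_all
      have "j \<notin> snd ` S"
      proof
        assume "j \<in> snd ` S"
        then obtain i where "(i, j) \<in> S" by auto
        then have "(i, j) \<in> col_block j" using S(1) by (auto simp: columns_def col_block_def)
        with \<open>(i, j) \<in> S\<close> cj True show False by blast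
      qed
      with j have "minors d 2 (col_block j) \<subseteq> ideal_I d k t S" using gens by blast
      then show ?thesis using contract[of "col_block j"] cj by simp
    next
      fix i assume i: "r = t" "i \<in> {1..2}" "J \<subseteq> row_block k i - S \<union> free_blocks k S"
      have "q \<in> minors d t J" using q i(1) unfolding minors_def by blast
      then have "q \<in> minors d t (row_block k i - S \<union> free_blocks k S)"
        using minors_mono[OF i(3)] by blast
      then show ?thesis using gens i(2) by blast
    qed
  qed
qed

text \<open>
  If \<open>S\<close> misses row block \<open>i\<close>, then every column outside \<open>S\<close> is either in row block \<open>i\<close> or free, so
  the \<open>t\<close>-minors of all columns outside \<open>S\<close> are already among the generators for \<open>S\<close>.
\<close>

lemma ideal_I_empty_psubset:
  assumes S: "S \<subseteq> columns k" "S \<noteq> {}" and i: "i \<in> {1..2}" "S `` {i} = {}"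
    and t: "2 \<le> t" "t \<le> d"
  shows "ideal_I d k t {} \<subset> ideal_I d k t S"
proof
  obtain i' where i': "i' \<in> {1..2}" "i' \<noteq> i" "{i, i'} = {1..2}" by (rule other_row[OF i(1)])
  have 1: "minors d 2 (col_block j) \<subseteq> ideal_I d k t S" if "j \<in> {1..k}" for j
  proof (rule minors_subset_ideal_I[OF S])
    fix J assume J: "J \<subseteq> col_block j - S" "card J = 2"
    then have "card (snd ` J) \<le> card {j}"
      by (intro card_mono) (auto simp: col_block_def)
    then show "card (snd ` J) < 2 \<or> 2 = t \<and> (\<exists>i \<in> {1..2}. J \<subseteq> row_block k i - S \<union> free_blocks k S)"
      by simp
  qed (use that in \<open>auto simp: col_block_def columns_def\<close>)
  have 2: "minors d t (columns k) \<subseteq> ideal_I d k t S"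
  proof (rule minors_subset_ideal_I[OF S subset_refl])
    fix J assume J: "J \<subseteq> columns k - S" "card J = t"
    have "J \<subseteq> row_block k i - S \<union> free_blocks k S"
    proof
      fix c assume c: "c \<in> J"
      obtain m j where mj: "c = (m, j)" by (cases c)
      with c J have m: "m \<in> {1..2}" "j \<in> {1..k}" "(m, j) \<notin> S" by (auto simp: columns_def)
      show "c \<in> row_block k i - S \<union> free_blocks k S"
      proof (cases "m = i")
        case True
        with m mj show ?thesis by (simp add: row_block_def)
      next
        case False
        with m i' have "m = i'" by blast
        have "(i, j) \<notin> S" using i by blast
        with m \<open>m = i'\<close> have "j \<notin> snd ` S" using row_mem_cases[OF S(1) _ i'(3)] by blast
        with m mj show ?thesis by (simp add: free_blocks_eq[OF S(1)])
      qed
    qed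
    with i show "card (snd ` J) < t \<or> t = t \<and> (\<exists>i \<in> {1..2}. J \<subseteq> row_block k i - S \<union> free_blocks k S)"
      by blast
  qed
  show "ideal_I d k t {} \<subseteq> ideal_I d k t S"
    using 1 2 by (intro ideal_I_subsetI[OF S(1)]) (simp add: gens_F_def UN_subset_iff)
  obtain c where c: "c \<in> S" using S by blast
  have "indet 1 c \<in> ideal_I d k t S" using indet_in_ideal_I[OF S(1) c] t by simp
  moreover have "indet 1 c \<notin> ideal_I d k t {}" using t by (intro indet_notin_ideal_I) auto
  ultimately show "ideal_I d k t {} \<noteq> ideal_I d k t S" by blast
qed

text \<open>
  Deleting \<open>(i, e)\<close> from \<open>S\<close> makes the second index \<open>e\<close> free and so adds the column \<open>(h, e)\<close> of the
  other row to the matrices with a rank condition. Because \<open>S `` {i}\<close> is large, few second indices remain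
  outside it, and every new minor repeats one of them.
\<close>

lemma ideal_I_delete_psubset:
  assumes S: "S \<subseteq> columns k" and proper: "\<forall>j \<in> {1..k}. \<not> col_block j \<subseteq> S"
    and ne: "\<And>i. i \<in> {1..2} \<Longrightarrow> S `` {i} \<noteq> {}"
    and i: "i \<in> {1..2}" "k + 2 \<le> card (S `` {i}) + t"
    and e: "(i, e) \<in> S" and t: "2 \<le> t" "t \<le> d"
  shows "ideal_I d k t (S - {(i, e)}) \<subset> ideal_I d k t S"
proof
  obtain h where h: "h \<in> {1..2}" "h \<noteq> i" "{i, h} = {1..2}" by (rule other_row[OF i(1)])
  define S' where "S' = S - {(i, e)}"
  have S': "S' \<subseteq> columns k" using S by (auto simp: S'_def)
  have disj: "(h, j) \<notin> S" if "(i, j) \<in> S" for j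
    using block_disjoint[OF S proper i(1) that h(1,2)] .
  have fin: "finite (S `` {m})" for m using row_indices_subset[OF S] finite_subset by blast
  have split: "snd ` S = S `` {i} \<union> S `` {h}"
    using row_mem_cases[OF S _ h(3)] by force
  have S0: "S \<noteq> {}" using e by blast
  have S'0: "S' \<noteq> {}" using ne[OF h(1)] h(2) by (auto simp: S'_def)
  have free': "free_blocks k S' = free_blocks k S \<union> col_block e"
  proof -
    have "snd ` S' = snd ` S - {e}"
    proof (intro equalityI subsetI)
      fix x assume x: "x \<in> snd ` S'"
      have "(i, e) \<notin> S'" "(h, e) \<notin> S'" using disj[OF e] by (simp_all add: S'_def)
      then have "x \<noteq> e" using row_mem_cases[OF S' x h(3)] by blast
      moreover have "x \<in> snd ` S" using x by (auto simp: S'_def)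
      ultimately show "x \<in> snd ` S - {e}" by simp
    next
      fix x assume "x \<in> snd ` S - {e}"
      then have "(i, x) \<in> S' \<or> (h, x) \<in> S'"
        using row_mem_cases[OF S _ h(3), of x] by (simp add: S'_def)
      then show "x \<in> snd ` S'" by (metis image_eqI snd_conv)
    qed
    moreover have "e \<in> {1..k}" using e S by (auto simp: columns_def)
    ultimately show ?thesis
      by (auto simp: free_blocks_eq[OF S] free_blocks_eq[OF S'] col_block_def)
  qed
  have pos: "1 \<le> card (S `` {h})" using ne[OF h(1)] fin by (simp add: Suc_le_eq card_gt_0_iff)
  have cS: "card (snd ` S) = card (S `` {i}) + card (S `` {h})"
    unfolding split using disj by (intro card_Un_disjoint fin) blast
  (* S ``{i} and S ``{h} are disjoint, so for t = 2 they would have k + 1 elements together. *)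
  have "card (snd ` S) \<le> card {1..k}"
    using S by (intro card_mono) (auto simp: columns_def)
  with cS pos i have t3: "3 \<le> t" by simp
  have G: "minors d (t - 1) (free_blocks k S') \<subseteq> ideal_I d k t S"
  proof (rule minors_subset_ideal_I[OF S S0])
    fix J assume J: "J \<subseteq> free_blocks k S' - S" "card J = t - 1"
    have "J \<subseteq> {1..2} \<times> ({1..k} - snd ` S) \<union> {1..2} \<times> {e}"
      using J(1) unfolding free' free_blocks_eq[OF S] col_block_def by (rule subset_trans) (rule Diff_subset)
    then have "snd ` J \<subseteq> snd ` ({1..2::nat} \<times> ({1..k} - snd ` S) \<union> {1..2} \<times> {e})"
      by (rule image_mono)
    also have "\<dots> \<subseteq> insert e ({1..k} - snd ` S)"
      unfolding image_Un snd_image_times by simp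
    finally have "card (snd ` J) \<le> card (insert e ({1..k} - snd ` S))"
      by (rule card_mono[rotated]) simp
    also have "\<dots> \<le> Suc (card ({1..k} - snd ` S))" by (rule card_insert_le_m1) simp_all
    also have "card ({1..k} - snd ` S) = k - card (snd ` S)"
      using S by (subst card_Diff_subset) (auto simp: columns_def split fin)
    finally have "card (snd ` J) < t - 1" using cS pos i t3 by simp
    then show "card (snd ` J) < t - 1 \<or> t - 1 = t \<and>
        (\<exists>i \<in> {1..2}. J \<subseteq> row_block k i - S \<union> free_blocks k S)" ..
  qed (rule free_blocks_subset_columns[OF S'])
  have H: "minors d t (row_block k m - S' \<union> free_blocks k S') \<subseteq> ideal_I d k t S" if m: "m \<in> {1..2}" for m
  proof (rule minors_subset_ideal_I[OF S S0])
    fix J assume J: "J \<subseteq> row_block k m - S' \<union> free_blocks k S' - S" "card J = t"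
    show "card (snd ` J) < t \<or> t = t \<and> (\<exists>i \<in> {1..2}. J \<subseteq> row_block k i - S \<union> free_blocks k S)"
    proof (cases "m = i")
      case True
      have "card (snd ` J) \<le> card (insert e ({1..k} - S `` {i}))"
        using J True split
        by (intro card_mono) (auto simp: free' free_blocks_eq[OF S] col_block_def row_block_def)
      also have "\<dots> \<le> Suc (card ({1..k} - S `` {i}))" by (rule card_insert_le_m1) simp_all
      also have "card ({1..k} - S `` {i}) = k - card (S `` {i})"
        using row_indices_subset[OF S] fin by (subst card_Diff_subset) auto
      finally have "card (snd ` J) < t" using i t3 by simp
      then show ?thesis ..
    next
      case False
      with m h have "m = h" by blast
      have ce: "col_block e = {(i, e), (h, e)}"
        using h(3) unfolding col_block_def by blast
      have he: "(h, e) \<in> row_block k h" using e S by (auto simp: columns_def row_block_def)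
      have "J \<subseteq> row_block k h - S \<union> free_blocks k S"
      proof
        fix c assume "c \<in> J"
        with J(1) have "c \<in> row_block k m - S' \<union> free_blocks k S' - S" by (rule subsetD)
        then have c: "c \<in> row_block k h \<or> c \<in> free_blocks k S \<or> c = (i, e) \<or> c = (h, e)" "c \<notin> S"
          unfolding \<open>m = h\<close> free' ce by blast+
        from c(1) show "c \<in> row_block k h - S \<union> free_blocks k S"
          by (elim disjE) (use c(2) e he in simp_all)
      qed
      with h show ?thesis by blast
    qed
  next
    show "row_block k m - S' \<union> free_blocks k S' \<subseteq> columns k"
      using row_block_subset_columns[OF m] free_blocks_subset_columns[OF S']
      by (intro Un_least) (simp_all add: le_supI1 Diff_subset[THEN subset_trans])
  qed
  have B: "minors d 2 (col_block j) \<subseteq> ideal_I d k t S" if "j \<in> {1..k}" for j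
  proof (rule minors_subset_ideal_I[OF S S0])
    fix J assume J: "J \<subseteq> col_block j - S" "card J = 2"
    then have "card (snd ` J) \<le> card {j}"
      by (intro card_mono) (auto simp: col_block_def)
    then show "card (snd ` J) < 2 \<or> 2 = t \<and> (\<exists>i \<in> {1..2}. J \<subseteq> row_block k i - S \<union> free_blocks k S)"
      by simp
  qed (use that in \<open>auto simp: col_block_def columns_def\<close>)
  have V: "minors d 1 S' \<subseteq> ideal_I d k t S"
    using minors_mono[of S' S d 1] gens_F_nonempty[OF S S0, of d t]
      gens_F_subset_ideal_I[OF S, of d t] by (auto simp: S'_def)
  have "gens_F d k t S' \<subseteq> ideal_I d k t S"
    using G H B V gens_G_subset[of d k t S'] unfolding gens_F_nonempty[OF S' S'0] by blast
  then show "ideal_I d k t (S - {(i, e)}) \<subseteq> ideal_I d k t S"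
    unfolding S'_def[symmetric] by (rule ideal_I_subsetI[OF S])
  have "indet 1 (i, e) \<in> ideal_I d k t S" using indet_in_ideal_I[OF S e] t by simp
  moreover have "indet 1 (i, e) \<notin> ideal_I d k t S'"
    using t t3 S' by (intro indet_notin_ideal_I) (auto simp: S'_def)
  ultimately show "ideal_I d k t (S - {(i, e)}) \<noteq> ideal_I d k t S"
    unfolding S'_def by blast
qed

text \<open>
  For \<open>t = 2\<close> the variables of all free columns are generators for \<open>S\<close>. Adding \<open>(1, j)\<close> to \<open>S\<close>
  keeps the variables of that column but loses those of \<open>(2, j)\<close>.
\<close>

lemma ideal_I_insert_psubset:
  assumes S: "S \<subseteq> columns k" and proper: "\<forall>j \<in> {1..k}. \<not> col_block j \<subseteq> S"
    and ne: "\<And>i. i \<in> {1..2} \<Longrightarrow> S `` {i} \<noteq> {}"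
    and j: "j \<in> {1..k}" "j \<notin> snd ` S" and d: "2 \<le> d"
  shows "ideal_I d k 2 (insert (1, j) S) \<subset> ideal_I d k 2 S"
proof
  define S' where "S' = insert (1, j) S"
  have S0: "S \<noteq> {}" using ne[of 1] by auto
  have S': "S' \<subseteq> columns k" "S' \<noteq> {}" using S j by (auto simp: S'_def columns_def)
  have free: "free_blocks k S' \<subseteq> free_blocks k S"
    unfolding free_blocks_eq[OF S] free_blocks_eq[OF S'(1)] by (auto simp: S'_def)
  have G: "gens_G d k 2 S = minors d 1 (free_blocks k S)"
    using gens_G_eq_minors[OF S proper ne] by simp
  have freej: "(m, j) \<in> free_blocks k S" if "m \<in> {1..2}" for m
    using that j by (simp add: free_blocks_eq[OF S])
  have 1: "minors d 1 S' \<subseteq> minors d 1 S \<union> minors d 1 (free_blocks k S)"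
  proof
    fix q assume "q \<in> minors d 1 S'"
    then obtain I c where "q = minor I {c}" "I \<subseteq> {1..d}" "card I = 1" "c \<in> S'"
      unfolding minors_def by (auto simp: card_1_singleton_iff)
    moreover from this freej[of 1] have "{c} \<subseteq> S \<or> {c} \<subseteq> free_blocks k S" by (auto simp: S'_def)
    moreover have "card {c} = 1" by simp
    ultimately show "q \<in> minors d 1 S \<union> minors d 1 (free_blocks k S)"
      unfolding minors_def by blast
  qed
  have 2: "minors d 2 (row_block k m - S' \<union> free_blocks k S')
      \<subseteq> minors d 2 (row_block k m - S \<union> free_blocks k S)" for m
    using free by (intro minors_mono) (auto simp: S'_def)
  have 3: "gens_G d k 2 S' \<subseteq> minors d 1 (free_blocks k S)"
    using gens_G_subset[of d k 2 S'] minors_mono[OF free, of d 1] by simp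
  have 4: "(\<Union>j \<in> {1..k} - snd ` S'. minors d 2 (col_block j))
      \<subseteq> (\<Union>j \<in> {1..k} - snd ` S. minors d 2 (col_block j))"
    by (rule UN_mono) (auto simp: S'_def)
  have 5: "(\<Union>i \<in> {1..2}. minors d 2 (row_block k i - S' \<union> free_blocks k S'))
      \<subseteq> (\<Union>i \<in> {1..2}. minors d 2 (row_block k i - S \<union> free_blocks k S))"
    by (rule UN_mono[OF subset_refl 2])
  have union: "A1 \<union> A2 \<union> A3 \<union> A4 \<subseteq> B1 \<union> B2 \<union> B3 \<union> B4"
    if "A1 \<subseteq> B1 \<union> B3" "A2 \<subseteq> B2" "A3 \<subseteq> B3" "A4 \<subseteq> B4" for A1 A2 A3 A4 B1 B2 B3 B4 :: "cpoly set"
    using that by blast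
  have "gens_F d k 2 S' \<subseteq> gens_F d k 2 S"
    unfolding gens_F_nonempty[OF S'] gens_F_nonempty[OF S S0] G
    by (rule union[OF 1 4 3 5])
  then show "ideal_I d k 2 (insert (1, j) S) \<subseteq> ideal_I d k 2 S"
    unfolding S'_def[symmetric] using gens_F_subset_ideal_I[OF S] by (intro ideal_I_subsetI[OF S]) blast
  have "indet 1 (2, j) \<in> gens_F d k 2 S"
    unfolding gens_F_nonempty[OF S S0] G
    using indet_in_minors[OF freej[of 2], of 1 d] d by auto
  then have "indet 1 (2, j) \<in> ideal_I d k 2 S" using gens_F_subset_ideal_I[OF S] by blast
  moreover have "indet 1 (2, j) \<notin> ideal_I d k 2 S'"
  proof (rule indet_notin_ideal_I[OF S'(1)])
    show "(2, j) \<notin> S'" using j by (auto simp: S'_def image_iff)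
    show "S' = {} \<or> 3 \<le> (2::nat) \<or> (2, j) \<notin> free_blocks k S'"
      by (simp add: free_blocks_eq[OF S'(1)]) (simp add: S'_def)
  qed simp_all
  ultimately show "ideal_I d k 2 (insert (1, j) S) \<noteq> ideal_I d k 2 S"
    unfolding S'_def by blast
qed

section \<open>The minimal ideals\<close>

text \<open>
  Points with a single nonzero entry give \<open>S' \<subseteq> S\<close>. An element \<open>(i, l)\<close> of \<open>S - S'\<close> makes \<open>l\<close> free
  in \<open>S'\<close>, so \<open>ideal_I d k t S'\<close> contains the \<open>t\<close>-minors on the column \<open>(h, l)\<close> of the other row
  together with \<open>t - 1\<close> further columns of row block \<open>i\<close> outside \<open>S\<close>. The bound on the size of
  \<open>S `` {i}\<close> leaves enough such columns to include one whose partner in the other row lies in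
  \<open>S\<close>, as the separating point requires.
\<close>

lemma ideal_I_subset_imp_eq:
  assumes S: "S \<subseteq> columns k" and proper: "\<forall>j \<in> {1..k}. \<not> col_block j \<subseteq> S"
    and t: "2 \<le> t" "t \<le> d"
    and rows: "S = {} \<or> (\<forall>i \<in> {1..2}. S `` {i} \<noteq> {} \<and> card (S `` {i}) + t \<le> k + 1)
      \<and> (t = 2 \<longrightarrow> snd ` S = {1..k})"
    and S': "S' \<subseteq> columns k" and sub: "ideal_I d k t S' \<subseteq> ideal_I d k t S"
  shows "S' = S"
proof (rule ccontr)
  assume "S' \<noteq> S"
  have "S' \<subseteq> S"
  proof
    fix c assume "c \<in> S'"
    then have "indet 1 c \<in> ideal_I d k t S'" using S' t by (intro indet_in_ideal_I) simp_all
    with sub have "indet 1 c \<in> ideal_I d k t S" by blast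
    moreover have "S = {} \<or> 3 \<le> t \<or> c \<notin> free_blocks k S"
      using rows t by (auto simp: free_blocks_eq[OF S])
    ultimately show "c \<in> S" using indet_notin_ideal_I[OF S _ _ t(1), of c 1 d] by auto
  qed
  with \<open>S' \<noteq> S\<close> obtain i l where il: "(i, l) \<in> S" "(i, l) \<notin> S'" by auto
  then have i: "i \<in> {1..2}" and l: "l \<in> {1..k}" using S by (auto simp: columns_def)
  obtain h where h: "h \<in> {1..2}" "h \<noteq> i" "{i, h} = {1..2}" by (rule other_row[OF i])
  have ol: "(h, l) \<notin> S" using block_disjoint[OF S proper i il(1) h(1,2)] .
  from rows il have rows': "S `` {i} \<noteq> {}" "S `` {h} \<noteq> {}" "card (S `` {i}) + t \<le> k + 1"
    using i h by auto
  define N where "N = {1..k} - S `` {i}"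
  have "card N = k - card (S `` {i})"
    unfolding N_def using row_indices_subset[OF S, of i] by (subst card_Diff_subset) (auto intro: finite_subset)
  then have cN: "t - 1 \<le> card N" using rows' by simp
  obtain \<beta> where \<beta>: "(h, \<beta>) \<in> S" using rows' by blast
  then have "\<beta> \<in> N"
    unfolding N_def using block_disjoint[OF S proper h(1) \<beta> i] h(2) S by (auto simp: columns_def)
  then have "\<exists>T. {\<beta>} \<subseteq> T \<and> T \<subseteq> N \<and> card T = t - 1"
    using cN t by (intro exists_subset_between) (simp_all add: N_def)
  then obtain T where T: "{\<beta>} \<subseteq> T" "T \<subseteq> N" "card T = t - 1" by blast
  have finT: "finite T" using T(2) by (rule finite_subset) (simp add: N_def)
  have lT: "l \<notin> T" using T il by (auto simp: N_def)
  (* The column (i, l) lies in S, so l is represented by its partner (h, l). *)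
  define J where "J = insert (h, l) ({i} \<times> T)"
  have snd_J: "snd ` J = insert l T" by (auto simp: J_def)
  have J: "J \<subseteq> columns k - S"
    using i h l ol T by (auto simp: J_def N_def columns_def)
  have inj: "inj_on snd J" using lT by (auto simp: J_def inj_on_def)
  then have cJ: "card J = t"
    using card_image[OF inj] lT finT T t by (simp add: snd_J)
  have meet: "snd ` J \<inter> S `` {m} \<noteq> {}" if "m \<in> {1..2}" for m
  proof -
    from that h(3) have "m = i \<or> m = h" by blast
    then show ?thesis using il \<beta> T(1) by (auto simp: snd_J)
  qed
  have "minors d t J \<subseteq> gens_F d k t S'"
  proof (cases "S' = {}")
    case True
    then show ?thesis using minors_mono[of J "columns k" d t] J by (auto simp: gens_F_def)
  next
    case False
    have "l \<notin> snd ` S'"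
      using row_mem_cases[OF S' _ h(3), of l] il(2) ol \<open>S' \<subseteq> S\<close> by blast
    then have "(h, l) \<in> free_blocks k S'" using h l by (simp add: free_blocks_eq[OF S'])
    moreover have "{i} \<times> T \<subseteq> row_block k i - S'"
      using T \<open>S' \<subseteq> S\<close> by (auto simp: row_block_def N_def)
    ultimately have "J \<subseteq> row_block k i - S' \<union> free_blocks k S'" by (auto simp: J_def)
    then show ?thesis
      using minors_mono[of J "row_block k i - S' \<union> free_blocks k S'" d t] i
      unfolding gens_F_nonempty[OF S' False] by blast
  qed
  with sub gens_F_subset_ideal_I[OF S', of d t] have "minors d t J \<subseteq> ideal_I d k t S" by blast
  moreover have "\<not> minors d t J \<subseteq> ideal_I d k t S"
    using meet[of 1] meet[of 2] by (intro transversal_minors_not_subset[OF S proper t _ _ J inj cJ]) simp_all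
  ultimately show False by contradiction
qed

lemma min_decomp_index_iff:
  assumes S: "S \<subseteq> columns k" and proper: "\<forall>j \<in> {1..k}. \<not> col_block j \<subseteq> S"
    and t: "2 \<le> t" "t \<le> d"
  shows "S \<in> min_decomp_index d k t \<longleftrightarrow> S = {} \<or>
    (\<forall>i \<in> {1..2}. S `` {i} \<noteq> {} \<and> card (S `` {i}) + t \<le> k + 1) \<and> (t = 2 \<longrightarrow> snd ` S = {1..k})"
    (is "_ \<longleftrightarrow> ?R")
proof
  assume "?R"
  then show "S \<in> min_decomp_index d k t"
    using ideal_I_subset_imp_eq[OF S proper t] S unfolding min_decomp_index_def by blast
next
  assume "S \<in> min_decomp_index d k t"
  then have min: "\<not> ideal_I d k t S' \<subset> ideal_I d k t S" if "S' \<subseteq> columns k" for S'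
    using that unfolding min_decomp_index_def by blast
  show ?R
  proof (cases "S = {}")
    case S0: False
    have ne: "S `` {i} \<noteq> {}" if "i \<in> {1..2}" for i
      using ideal_I_empty_psubset[OF S S0 that _ t] min[of "{}"] by blast
    have "card (S `` {i}) + t \<le> k + 1" if i: "i \<in> {1..2}" for i
    proof (rule ccontr)
      assume "\<not> card (S `` {i}) + t \<le> k + 1"
      moreover obtain e where "(i, e) \<in> S" using ne[OF i] by blast
      ultimately show False
        using ideal_I_delete_psubset[OF S proper ne i _ _ t, of e] min[of "S - {(i, e)}"] S by auto
    qed
    moreover have "snd ` S = {1..k}" if "t = 2"
    proof (rule ccontr)
      assume "snd ` S \<noteq> {1..k}"
      moreover have "snd ` S \<subseteq> {1..k}" using S by (auto simp: columns_def)
      ultimately obtain j where j: "j \<in> {1..k}" "j \<notin> snd ` S" by blast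
      moreover from j S have "insert (1, j) S \<subseteq> columns k" by (auto simp: columns_def)
      ultimately show False
        using ideal_I_insert_psubset[OF S proper ne j] min[of "insert (1, j) S"] t that by blast
    qed
    ultimately show ?thesis using ne by blast
  qed simp
qed

section \<open>Counting the combinatorial types\<close>

lemma comb_type_row_indices:
  assumes "S \<subseteq> columns k"
  shows "comb_type k S = (min (card (S `` {1})) (card (S `` {2})), max (card (S `` {1})) (card (S `` {2})))"
proof -
  have "card (row_block k i \<inter> S) = card (S `` {i})" if "i \<in> {1..2}" for i
  proof -
    have "row_block k i \<inter> S = Pair i ` (S `` {i})"
      using row_indices_subset[OF assms, of i] by (auto simp: row_block_def)
    then show ?thesis by (simp add: card_image inj_on_def)
  qed
  then show ?thesis by (simp add: comb_type_def)
qed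

text \<open>
  Each admissible pair \<open>(u, v)\<close> is realised by the second indices \<open>1, \<dots>, u\<close> in the first row and
  \<open>u + 1, \<dots>, u + v\<close> in the second.
\<close>

lemma comb_type_min_decomp_index:
  assumes t: "2 \<le> t" "t \<le> k" "t \<le> d"
  shows "comb_type k ` {S \<in> min_decomp_index d k t. \<forall>j \<in> {1..k}. \<not> col_block j \<subseteq> S}
    = insert (0, 0) {(u, v). 1 \<le> u \<and> u \<le> v \<and> v \<le> k + 1 - t \<and> u + v \<le> k \<and> (t = 2 \<longrightarrow> u + v = k)}"
    (is "?L = insert _ ?R")
proof (intro equalityI subsetI)
  fix p assume "p \<in> ?L"
  then obtain S where S: "S \<in> min_decomp_index d k t" "\<forall>j \<in> {1..k}. \<not> col_block j \<subseteq> S"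
      and p: "p = comb_type k S" by blast
  from S(1) have SC: "S \<subseteq> columns k" by (simp add: min_decomp_index_def)
  show "p \<in> insert (0, 0) ?R"
  proof (cases "S = {}")
    case True
    then show ?thesis by (simp add: p comb_type_def)
  next
    case False
    with min_decomp_index_iff[OF SC S(2) t(1,3)] S(1)
    have rows: "\<forall>i \<in> {1..2}. S `` {i} \<noteq> {} \<and> card (S `` {i}) + t \<le> k + 1"
      and full: "t = 2 \<longrightarrow> snd ` S = {1..k}" by simp_all
    have ne: "S `` {i} \<noteq> {}" "card (S `` {i}) + t \<le> k + 1" if "i \<in> {1..2}" for i
      using bspec[OF rows that] by simp_all
    have fin: "finite (S `` {i})" for i
      using row_indices_subset[OF SC] by (rule finite_subset) simp
    have "S `` {1} \<inter> S `` {2} = {}"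
      using block_disjoint[OF SC S(2), of 1 _ 2] by auto
    moreover have "snd ` S = S `` {1} \<union> S `` {2}"
    proof -
      have "{1..2} = {1, 2 :: nat}" by auto
      then show ?thesis using row_mem_cases[OF SC, of _ 1 2] by force
    qed
    ultimately have sum: "card (snd ` S) = card (S `` {1}) + card (S `` {2})"
      using fin by (simp add: card_Un_disjoint)
    have "snd ` S \<subseteq> {1..k}"
      using image_mono[OF SC, of snd] by (simp add: columns_def)
    then have "card (snd ` S) \<le> card {1..k}" by (intro card_mono) simp
    with sum have le: "card (S `` {1}) + card (S `` {2}) \<le> k" by simp
    have pos: "1 \<le> card (S `` {i})" if "i \<in> {1..2}" for i
      using ne(1)[OF that] fin by (simp add: Suc_le_eq card_gt_0_iff)
    have eq: "card (S `` {1}) + card (S `` {2}) = k" if "t = 2"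
      using full that sum by simp
    show ?thesis
      using le eq pos[of 1] pos[of 2] ne(2)[of 1] ne(2)[of 2]
      by (auto simp: p comb_type_row_indices[OF SC] min_def max_def)
  qed
next
  fix p assume "p \<in> insert (0, 0) ?R"
  then consider "p = (0, 0)" | u v where "p = (u, v)" "1 \<le> u" "u \<le> v" "v + t \<le> k + 1" "u + v \<le> k"
      "t = 2 \<longrightarrow> u + v = k" using t by auto
  then show "p \<in> ?L"
  proof cases
    case 1
    have proper: "\<forall>j \<in> {1..k}. \<not> col_block j \<subseteq> {}" by (simp add: col_block_def)
    then have "{} \<in> min_decomp_index d k t"
      using min_decomp_index_iff[OF empty_subsetI proper t(1,3)] by simp
    with proper have "comb_type k {} \<in> ?L" by blast
    then show ?thesis using 1 by (simp add: comb_type_def)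
  next
    case 2
    define S where "S = {1::nat} \<times> {1..u} \<union> {2} \<times> {u + 1..u + v}"
    have SC: "S \<subseteq> columns k" using 2(5) by (auto simp: S_def columns_def)
    have im: "S `` {1} = {1..u}" "S `` {2} = {u + 1..u + v}" by (auto simp: S_def)
    have proper: "\<not> col_block j \<subseteq> S" for j
    proof
      assume "col_block j \<subseteq> S"
      moreover have "(1, j) \<in> col_block j" "(2, j) \<in> col_block j" by (simp_all add: col_block_def)
      ultimately have "(1, j) \<in> S" "(2, j) \<in> S" by (auto dest: subsetD)
      then show False by (simp add: S_def)
    qed
    have "snd ` S = {1..u + v}"
      unfolding S_def image_Un snd_image_times using 2(2) by auto
    moreover have "\<forall>i \<in> {1..2}. S `` {i} \<noteq> {} \<and> card (S `` {i}) + t \<le> k + 1"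
    proof
      fix i :: nat assume "i \<in> {1..2}"
      then have "i = 1 \<or> i = 2" by auto
      then have "S `` {i} = {1..u} \<or> S `` {i} = {u + 1..u + v}" using im by metis
      then show "S `` {i} \<noteq> {} \<and> card (S `` {i}) + t \<le> k + 1"
        using 2 by auto
    qed
    ultimately have "S \<in> min_decomp_index d k t"
      using min_decomp_index_iff[OF SC _ t(1,3)] proper 2(6) by simp
    with proper have "comb_type k S \<in> ?L" by blast
    moreover have "comb_type k S = p"
      unfolding comb_type_row_indices[OF SC] im using 2 by simp
    ultimately show ?thesis by simp
  qed
qed

lemma card_ordered_pairs_sum_eq:
  "card {(u, v). 1 \<le> u \<and> u \<le> v \<and> v \<le> k - 1 \<and> u + v \<le> k \<and> u + v = (k::nat)} = k div 2"
proof -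
  have "{(u, v). 1 \<le> u \<and> u \<le> v \<and> v \<le> k - 1 \<and> u + v \<le> k \<and> u + v = k} = (\<lambda>u. (u, k - u)) ` {1..k div 2}"
    by (auto simp: image_iff)
  then show ?thesis by (simp add: card_image inj_on_def)
qed

text \<open>
  Here \<open>v \<le> m\<close> implies \<open>u + v \<le> k\<close>, so this is the number of pairs \<open>u \<le> v\<close> in \<open>{1..m}\<close>.
\<close>

lemma card_ordered_pairs_le_square:
  assumes "2 * m \<le> k"
  shows "2 * card {(u, v). 1 \<le> u \<and> u \<le> v \<and> v \<le> m \<and> u + v \<le> (k::nat)} = m * (m + 1)"
proof -
  have "{(u, v). 1 \<le> u \<and> u \<le> v \<and> v \<le> m \<and> u + v \<le> k} = (SIGMA v : {1..m}. {1..v})\<inverse>"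
    using assms by auto
  then have "card {(u, v). 1 \<le> u \<and> u \<le> v \<and> v \<le> m \<and> u + v \<le> k} = card (SIGMA v : {1..m}. {1..v})"
    by simp
  also have "\<dots> = (\<Sum>v = 1..m. v)" by simp
  finally have "card {(u, v). 1 \<le> u \<and> u \<le> v \<and> v \<le> m \<and> u + v \<le> k} = (\<Sum>v = 1..m. v)" .
  moreover have "2 * (\<Sum>v = 1..m. v) = m * (m + 1)" by (induction m) simp_all
  ultimately show ?thesis by simp
qed

text \<open>
  The pairs \<open>u \<le> v\<close> with \<open>u + v \<le> k\<close> are counted by \<open>u \<le> k div 2\<close>; those with \<open>v > m\<close> are then
  subtracted. As \<open>2 * m > k\<close>, the latter form a full triangle, since \<open>u \<le> k - m\<close> implies
  \<open>u \<le> m\<close>.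
\<close>

lemma card_ordered_pairs_sum_le:
  assumes m: "m \<le> k" "k < 2 * m"
  shows "real (card {(u, v). 1 \<le> u \<and> u \<le> v \<and> v \<le> m \<and> u + v \<le> (k::nat)})
    = ((real k)\<^sup>2 - (if even k then 0 else 1)) / 4 - (real k - real m) * (real k - real m - 1) / 2"
proof -
  define r where "r = k - m"
  have sums: "(\<Sum>u = 1..n. real (k + 1 - 2 * u)) = real n * (real k - real n)" if "2 * n \<le> k" for n
    using that by (induction n) (auto simp: of_nat_diff algebra_simps)
  have sums': "(\<Sum>u = 1..n. real (r + 1 - u)) = real n * (2 * real r + 1 - real n) / 2" if "n \<le> r" for n
    using that by (induction n) (auto simp: of_nat_diff field_simps)
  (* A: all pairs u <= v with sum at most k; B: those among them with v > m. *)
  define A where "A = (SIGMA u : {1..k div 2}. {u..k - u})"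
  define B where "B = (SIGMA u : {1..r}. {m + 1..k - u})"
  have fin: "finite A" "finite B" by (simp_all add: A_def B_def)
  have sub: "B \<subseteq> A"
  proof
    fix p assume "p \<in> B"
    then show "p \<in> A" using m by (cases p) (auto simp: A_def B_def r_def)
  qed
  have "{(u, v). 1 \<le> u \<and> u \<le> v \<and> v \<le> m \<and> u + v \<le> k} = A - B"
    using m by (auto simp: A_def B_def r_def)
  then have "card {(u, v). 1 \<le> u \<and> u \<le> v \<and> v \<le> m \<and> u + v \<le> k} = card A - card B"
    using fin sub by (simp add: card_Diff_subset)
  moreover have "card B \<le> card A" using fin sub by (intro card_mono)
  moreover have "real (card A) = real (k div 2) * (real k - real (k div 2))"
  proof -
    have "card A = (\<Sum>u = 1..k div 2. k + 1 - 2 * u)"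
      unfolding A_def by (subst card_SigmaI) (auto intro!: sum.cong)
    then show ?thesis using sums[of "k div 2"] by simp
  qed
  moreover have "real (card B) = real r * (real r - 1) / 2"
  proof -
    have "card B = (\<Sum>u = 1..r. r - u)"
      unfolding B_def using m by (subst card_SigmaI) (auto intro!: sum.cong simp: r_def)
    moreover have "real (\<Sum>u = 1..r. r - u) = (\<Sum>u = 1..r. real (r + 1 - u) - 1)"
      unfolding of_nat_sum by (intro sum.cong) (auto simp: of_nat_diff)
    ultimately show ?thesis using sums'[of r] by (simp add: sum_subtractf field_simps)
  qed
  moreover have "real r = real k - real m" using m by (simp add: r_def of_nat_diff)
  moreover have "real (k div 2) = (if even k then real k / 2 else (real k - 1) / 2)"
    by (auto simp: real_of_nat_div elim!: evenE oddE)
  ultimately show ?thesis by (auto simp: of_nat_diff field_simps power2_eq_square)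
qed

theorem proposition3p9:
  fixes d k2 t :: nat
  assumes "2 \<le> t" and "t \<le> min k2 d"
  shows "(t = 2 \<longrightarrow> int (num_comb_types d k2 t) = \<lfloor>real k2 / 2\<rfloor> + 1) \<and>
    (t \<ge> 3 \<longrightarrow>
      (real t - 1 \<ge> real k2 / 2 \<longrightarrow>
         real (num_comb_types d k2 t) =
           1 / 2 * (real k2 - real t + 1) * (real k2 - real t + 2) + 1) \<and>
      (real t - 1 < real k2 / 2 \<and> even k2 \<longrightarrow>
         real (num_comb_types d k2 t) =
           1 / 4 * ((real k2)\<^sup>2 - 2 * (real t)\<^sup>2 + 6 * real t)) \<and>
      (real t - 1 < real k2 / 2 \<and> odd k2 \<longrightarrow>
         real (num_comb_types d k2 t) =
           1 / 4 * ((real k2)\<^sup>2 - 2 * (real t)\<^sup>2 + 6 * real t - 1)))"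
proof (intro conjI impI)
  have t: "2 \<le> t" "t \<le> k2" "t \<le> d" using assms by simp_all
  define P where "P = {(u, v). 1 \<le> u \<and> u \<le> v \<and> v \<le> k2 + 1 - t \<and> u + v \<le> k2 \<and> (t = 2 \<longrightarrow> u + v = k2)}"
  have "finite P"
    by (rule finite_subset[of _ "{..k2} \<times> {..k2}"]) (auto simp: P_def)
  then have count: "num_comb_types d k2 t = card P + 1"
    unfolding num_comb_types_def comb_type_min_decomp_index[OF t] P_def[symmetric]
    by (subst card_insert_disjoint) (auto simp: P_def)
  {
    assume "t = 2"
    then have "card P = k2 div 2"
      using card_ordered_pairs_sum_eq[of k2] by (simp add: P_def)
    moreover have "\<lfloor>real k2 / 2\<rfloor> = int (k2 div 2)"
      using floor_divide_of_nat_eq[of k2 2] by simp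
    ultimately show "int (num_comb_types d k2 t) = \<lfloor>real k2 / 2\<rfloor> + 1"
      by (simp add: count)
  }
  assume t3: "3 \<le> t"
  then have P: "P = {(u, v). 1 \<le> u \<and> u \<le> v \<and> v \<le> k2 + 1 - t \<and> u + v \<le> k2}"
    by (simp add: P_def)
  have m: "real (k2 + 1 - t) = real k2 + 1 - real t" using t by (simp add: of_nat_diff)
  {
    assume "real k2 / 2 \<le> real t - 1"
    then have "2 * (k2 + 1 - t) \<le> k2" using t by linarith
    then have "2 * card P = (k2 + 1 - t) * (k2 + 1 - t + 1)"
      unfolding P by (rule card_ordered_pairs_le_square)
    then have "real (2 * card P) = real ((k2 + 1 - t) * (k2 + 1 - t + 1))" by (rule arg_cong)
    then have "2 * real (card P) = (real k2 + 1 - real t) * (real k2 + 1 - real t + 1)"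
      unfolding of_nat_mult of_nat_add[of _ 1] m by simp
    then show "real (num_comb_types d k2 t) = 1 / 2 * (real k2 - real t + 1) * (real k2 - real t + 2) + 1"
      unfolding count by (simp add: field_simps)
  }
  have large: "real (num_comb_types d k2 t)
      = ((real k2)\<^sup>2 - 2 * (real t)\<^sup>2 + 6 * real t - (if even k2 then 0 else 1)) / 4"
    if "real t - 1 < real k2 / 2"
  proof -
    have "k2 < 2 * (k2 + 1 - t)" "k2 + 1 - t \<le> k2" using that t by linarith+
    then have "real (card P) = ((real k2)\<^sup>2 - (if even k2 then 0 else 1)) / 4
        - (real t - 1) * (real t - 2) / 2"
      using card_ordered_pairs_sum_le[of "k2 + 1 - t" k2] unfolding P m by simp
    then show ?thesis by (simp add: count field_simps power2_eq_square)
  qed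
  show "real (num_comb_types d k2 t) = 1 / 4 * ((real k2)\<^sup>2 - 2 * (real t)\<^sup>2 + 6 * real t)"
    if "real t - 1 < real k2 / 2 \<and> even k2"
    using large that by simp
  show "real (num_comb_types d k2 t) = 1 / 4 * ((real k2)\<^sup>2 - 2 * (real t)\<^sup>2 + 6 * real t - 1)"
    if "real t - 1 < real k2 / 2 \<and> odd k2"
    using large that by simp
qed

end
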